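(* In the setting described in the context (plant with $m$ independent lossy actuation channels with mean packet transmission matrix $\mathbf M$, horizon $N$, information sets $\mathcal F_k$ (TCP-like) and $\mathcal G_k$ (UDP-like), and optimal cost $J^*(\mathcal I_k)$), let $\mathbf M$ be such that $\mathbf 0\prec\mathbf M\prec\mathbf I$. Then $$J^*(\mathcal G_k)-J^*(\mathcal F_k)>0 .$$
   Context: Plant: $X_{k+1}=\mathbf A X_k+\mathbf B\mathbf V_kU_k+W_k$ with $\mathbf A\in\mathbb R^{n\times n}$, $\mathbf B\in\mathbb R^{n\times m}$. The noise $W_k\in\mathbb R^n$ is Gaussian with mean $0$ and positive definite covariance $\Sigma_W$, independent over time. $\mathbf V_k$ is a diagonal $m\times m$ random matrix whose diagonal entries are Bernoulli, the $i$-th with mean $\mu_i$; all these Bernoulli variables are independent over $i$ and $k$ and independent of the noise. $\mathbb E[\mathbf V_k]=\mathbf M=\operatorname{diag}(\mu_1,\dots,\mu_m)$, $\mu_i\in[0,1]$. The state $X_k$ is Gaussian with positive definite covariance and is known to the controller at time $k$. Information sets: TCP-like $\mathcal F_k=\{X_0,\dots,X_k,\mathbf V_0,\dots,\mathbf V_{k-1}\}$; UDP-like $\mathcal G_k=\{X_0,\dots,X_k\}$; $\mathcal I_k$ denotes either. $\prec$ is the Loewner order. Over a horizon $N\ge1$ the dynamics are stacked as $\mathcal X_k=\Phi X_k+\Gamma\Upsilon_k\mathcal U_k(\mathcal I_k)+\Lambda\mathcal W_k$, where $\mathcal X_k=(X_{k+1},\dots,X_{k+N})$, $\mathcal W_k=(W_k,\dots,W_{k+N-1})$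 with block-diagonal covariance $\Sigma_{\mathcal W}=\mathbf I_N\otimes\Sigma_W$, $\Upsilon_k=\operatorname{blockdiag}(\mathbf V_k,\dots,\mathbf V_{k+N-1})$, $\overline\Upsilon=\mathbb E[\Upsilon_k]=\mathbf I_N\otimes\mathbf M$, $\Phi$ is the block column $(\mathbf A,\mathbf A^2,\dots,\mathbf A^N)$, $\Gamma$ is block lower triangular with $(i,j)$ block $\mathbf A^{i-j}\mathbf B$ for $i\ge j$, and $\Lambda$ is block lower triangular with $(i,j)$ block $\mathbf A^{i-j}$ for $i\ge j$. The stacked input $\mathcal U_k(\mathcal I_k)\in\mathbb R^{Nm}$ is a function of $\mathcal I_k$. Predicted trajectory (both protocols): $\widehat{\mathcal X}_k=\Phi X_k+\Gamma\overline\Upsilon\,\mathcal U_k(\mathcal I_k)$. Errors: $\mathbf E_k(\mathcal F_k)=\mathcal X_k-\mathbb E[\mathcal X_k\mid\mathcal F_k,\Upsilon_k]=\Lambda\mathcal W_k$ (TCP-like) and $\mathbf E_k(\mathcal G_k)=\mathcal X_k-\mathbb E[\mathcal X_k\mid\mathcal G_k]=\Gamma(\Upsilon_k-\overline\Upsilon)\mathcal U_k(\mathcal G_k)+\Lambda\mathcal W_k$ (UDP-like). Optimal cost, with $\Omega\in\mathbb R^{Nn\times Nn}$, $\Psi\in\mathbb R^{Nm\times Nm}$, $\mathbf Q\in\mathbb R^{n\times n}$ diagonal positive definite: $$J^*(\mathcal I_k)=\min_{\mathcal U_k(\mathcal I_k)}\mathbb E\big[X_k^{\sf T}\mathbf QX_k+\widehat{\mathcal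 X}_k^{\sf T}\Omega\widehat{\mathcal X}_k+\mathbf E_k^{\sf T}\Omega\mathbf E_k+\mathcal U_k(\mathcal I_k)^{\sf T}\Upsilon_k^{\sf T}\Psi\Upsilon_k\,\mathcal U_k(\mathcal I_k)\,\big|\,\mathcal I_k\big],$$ where $\mathbf E_k=\mathbf E_k(\mathcal I_k)$.
   Formalization: Adds the hypothesis Γ^TΩΦ ≠ 0: when it fails (e.g. A = 0 or B = 0) the zero input is optimal for both protocols and the difference is 0. The inequality is proved almost surely (it fails on the null event X_k = 0), with Ω, Ψ and Q all taken diagonal positive definite. *)

theory Defs
  imports "HOL-Probability.Probability"
begin

section \<open>Matrices\<close>

definition diag :: "real^'n \<Rightarrow> real^'n^'n" where
  "diag d = (\<chi> i j. if i = j then d $ i else 0)"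

definition is_diagonal :: "real^'n^'n \<Rightarrow> bool" where
  "is_diagonal S \<longleftrightarrow> (\<forall>i j. i \<noteq> j \<longrightarrow> S $ i $ j = 0)"

definition pos_definite :: "real^'n^'n \<Rightarrow> bool" where
  "pos_definite S \<longleftrightarrow> transpose S = S \<and> (\<forall>x. x \<noteq> 0 \<longrightarrow> x \<bullet> (S *v x) > 0)"

definition loewner_less :: "real^'n^'n \<Rightarrow> real^'n^'n \<Rightarrow> bool"  (infix "\<prec>\<^sub>L" 50) where
  "S \<prec>\<^sub>L T \<longleftrightarrow> pos_definite (T - S)"

primrec mat_pow :: "real^'n^'n \<Rightarrow> nat \<Rightarrow> real^'n^'n" where
  "mat_pow S 0 = mat 1"
| "mat_pow S (Suc l) = S ** mat_pow S l"


section \<open>Stacking over the horizon\<close>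

text \<open>
  The horizon is a finite linearly ordered index type \<open>'h\<close>, so that \<open>N = CARD('h) \<ge> 1\<close>; a stacked
  vector of \<open>N\<close> blocks from \<open>real^'n\<close> is an element of \<open>real^('h \<times> 'n)\<close>.  Block indices are counted
  from 0 by \<open>blk\<close>: the block with \<open>blk i = l\<close> is the \<open>(l+1)\<close>-th block in the usual numbering.
\<close>

definition blk :: "'h::{finite,linorder} \<Rightarrow> nat" where
  "blk i = card {j. j < i}"

definition stack :: "(nat \<Rightarrow> real^'n) \<Rightarrow> real^('h::{finite,linorder} \<times> 'n)" where
  "stack f = (\<chi> p. f (blk (fst p)) $ snd p)"

definition block_diag :: "(nat \<Rightarrow> real^'m^'m) \<Rightarrow> real^('h::{finite,linorder} \<times> 'm)^('h \<times> 'm)" where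
  "block_diag D = (\<chi> p q. if fst p = fst q then D (blk (fst p)) $ snd p $ snd q else 0)"

definition Phi :: "real^'n^'n \<Rightarrow> real^'n^('h::{finite,linorder} \<times> 'n)" where
  "Phi A = (\<chi> p b. mat_pow A (blk (fst p) + 1) $ snd p $ b)"

definition Gamma ::
  "real^'n^'n \<Rightarrow> real^'m^'n \<Rightarrow> real^('h::{finite,linorder} \<times> 'm)^('h \<times> 'n)" where
  "Gamma A B = (\<chi> p q. if fst q \<le> fst p
     then (mat_pow A (blk (fst p) - blk (fst q)) ** B) $ snd p $ snd q else 0)"

definition Lambda :: "real^'n^'n \<Rightarrow> real^('h::{finite,linorder} \<times> 'n)^('h \<times> 'n)" where
  "Lambda A = (\<chi> p q. if fst q \<le> fst p
     then mat_pow A (blk (fst p) - blk (fst q)) $ snd p $ snd q else 0)"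


section \<open>Random vectors and information\<close>

text \<open>
  A random vector is Gaussian with mean \<open>c\<close> and (positive definite) covariance \<open>S\<close> if every nonzero
  linear functional of it is univariate normal with the corresponding mean and variance.  This is
  meant for positive definite \<open>S\<close> only: \<open>normal_density\<close> does not describe point masses.
\<close>

definition gaussian_vector ::
  "'a measure \<Rightarrow> ('a \<Rightarrow> real^'n) \<Rightarrow> real^'n \<Rightarrow> real^'n^'n \<Rightarrow> bool" where
  "gaussian_vector M Z c S \<longleftrightarrow> Z \<in> borel_measurable M \<and>
     (\<forall>a. a \<noteq> 0 \<longrightarrow>
        distributed M lborel (\<lambda>\<omega>. a \<bullet> Z \<omega>) (normal_density (a \<bullet> c) (sqrt (a \<bullet> (S *v a)))))"

definition preimages :: "'a measure \<Rightarrow> ('a \<Rightarrow> 'b) \<Rightarrow> 'b measure \<Rightarrow> 'a set set" where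
  "preimages M f N = {f -` S \<inter> space M | S. S \<in> sets N}"

text \<open>\<open>L k i \<omega>\<close> tells whether the transmission over channel \<open>i\<close> at time \<open>k\<close> succeeds.\<close>

definition Vmat :: "(nat \<Rightarrow> 'm::finite \<Rightarrow> 'a \<Rightarrow> bool) \<Rightarrow> nat \<Rightarrow> 'a \<Rightarrow> real^'m^'m" where
  "Vmat L k \<omega> = diag (\<chi> i. of_bool (L k i \<omega>))"

datatype 'm source = Init | Noise nat | Channel nat 'm

text \<open>Joint independence of the initial state, all noise vectors and all channel outcomes.\<close>

definition independent_sources ::
  "'a measure \<Rightarrow> ('a \<Rightarrow> real^'n) \<Rightarrow> (nat \<Rightarrow> 'a \<Rightarrow> real^'n) \<Rightarrow> (nat \<Rightarrow> 'm::finite \<Rightarrow> 'a \<Rightarrow> bool) \<Rightarrow> bool" where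
  "independent_sources M X0 W L \<longleftrightarrow> prob_space.indep_sets M
     (\<lambda>s. case s of
            Init \<Rightarrow> preimages M X0 borel
          | Noise k \<Rightarrow> preimages M (W k) borel
          | Channel k i \<Rightarrow> preimages M (L k i) (count_space UNIV)) UNIV"

definition info_udp :: "'a measure \<Rightarrow> (nat \<Rightarrow> 'a \<Rightarrow> real^'n) \<Rightarrow> nat \<Rightarrow> 'a measure" where
  "info_udp M X k = sigma (space M) (\<Union>j\<le>k. preimages M (X j) borel)"

definition info_tcp ::
  "'a measure \<Rightarrow> (nat \<Rightarrow> 'a \<Rightarrow> real^'n) \<Rightarrow> (nat \<Rightarrow> 'm::finite \<Rightarrow> 'a \<Rightarrow> bool) \<Rightarrow> nat \<Rightarrow> 'a measure" where
  "info_tcp M X L k = sigma (space M)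
     ((\<Union>j\<le>k. preimages M (X j) borel) \<union> (\<Union>j<k. preimages M (Vmat L j) borel))"

definition info_join :: "'a measure \<Rightarrow> 'a measure \<Rightarrow> ('a \<Rightarrow> 'b::topological_space) \<Rightarrow> 'a measure" where
  "info_join M I f = sigma (space M) (sets I \<union> preimages M f borel)"

definition cond_exp_vec :: "'a measure \<Rightarrow> 'a measure \<Rightarrow> ('a \<Rightarrow> real^'d) \<Rightarrow> 'a \<Rightarrow> real^'d" where
  "cond_exp_vec M I Z \<omega> = (\<chi> i. real_cond_exp M I (\<lambda>\<omega>'. Z \<omega>' $ i) \<omega>)"


section \<open>Predicted trajectory, errors and optimal cost\<close>

text \<open>\<open>U\<close> below is the stacked input, regarded as a random vector.\<close>

definition Ups :: "(nat \<Rightarrow> 'm::finite \<Rightarrow> 'a \<Rightarrow> bool) \<Rightarrow> nat \<Rightarrow> 'a \<Rightarrow> real^('h::{finite,linorder} \<times> 'm)^('h \<times> 'm)" where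
  "Ups L k \<omega> = block_diag (\<lambda>l. Vmat L (k + l) \<omega>)"

definition Ups_mean :: "real^'m \<Rightarrow> real^('h::{finite,linorder} \<times> 'm)^('h \<times> 'm)" where
  "Ups_mean \<mu> = block_diag (\<lambda>l. diag \<mu>)"

definition stacked_state ::
  "real^'n^'n \<Rightarrow> real^'m^'n \<Rightarrow> (nat \<Rightarrow> 'a \<Rightarrow> real^'n) \<Rightarrow> (nat \<Rightarrow> 'a \<Rightarrow> real^'n) \<Rightarrow>
   (nat \<Rightarrow> 'm::finite \<Rightarrow> 'a \<Rightarrow> bool) \<Rightarrow> nat \<Rightarrow> ('a \<Rightarrow> real^('h \<times> 'm)) \<Rightarrow>
   'a \<Rightarrow> real^('h::{finite,linorder} \<times> 'n)" where
  "stacked_state A B X W L k U \<omega> =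
     Phi A *v X k \<omega> + Gamma A B *v (Ups L k \<omega> *v U \<omega>) + Lambda A *v stack (\<lambda>l. W (k + l) \<omega>)"

definition predicted_state ::
  "real^'n^'n \<Rightarrow> real^'m^'n \<Rightarrow> real^'m \<Rightarrow> (nat \<Rightarrow> 'a \<Rightarrow> real^'n) \<Rightarrow> nat \<Rightarrow>
   ('a \<Rightarrow> real^('h \<times> 'm)) \<Rightarrow> 'a \<Rightarrow> real^('h::{finite,linorder} \<times> 'n)" where
  "predicted_state A B \<mu> X k U \<omega> = Phi A *v X k \<omega> + Gamma A B *v (Ups_mean \<mu> *v U \<omega>)"

definition error_tcp ::
  "'a measure \<Rightarrow> real^'n^'n \<Rightarrow> real^'m^'n \<Rightarrow> (nat \<Rightarrow> 'a \<Rightarrow> real^'n) \<Rightarrow> (nat \<Rightarrow> 'a \<Rightarrow> real^'n) \<Rightarrow>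
   (nat \<Rightarrow> 'm::finite \<Rightarrow> 'a \<Rightarrow> bool) \<Rightarrow> nat \<Rightarrow> ('a \<Rightarrow> real^('h \<times> 'm)) \<Rightarrow>
   'a \<Rightarrow> real^('h::{finite,linorder} \<times> 'n)" where
  "error_tcp M A B X W L k U \<omega> = stacked_state A B X W L k U \<omega> -
     cond_exp_vec M
       (info_join M (info_tcp M X L k) (Ups L k :: 'a \<Rightarrow> real^('h \<times> 'm)^('h \<times> 'm)))
       (stacked_state A B X W L k U) \<omega>"

definition error_udp ::
  "'a measure \<Rightarrow> real^'n^'n \<Rightarrow> real^'m^'n \<Rightarrow> (nat \<Rightarrow> 'a \<Rightarrow> real^'n) \<Rightarrow> (nat \<Rightarrow> 'a \<Rightarrow> real^'n) \<Rightarrow>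
   (nat \<Rightarrow> 'm::finite \<Rightarrow> 'a \<Rightarrow> bool) \<Rightarrow> nat \<Rightarrow> ('a \<Rightarrow> real^('h \<times> 'm)) \<Rightarrow>
   'a \<Rightarrow> real^('h::{finite,linorder} \<times> 'n)" where
  "error_udp M A B X W L k U \<omega> = stacked_state A B X W L k U \<omega> -
     cond_exp_vec M (info_udp M X k) (stacked_state A B X W L k U) \<omega>"

definition running_cost ::
  "real^'n^'n \<Rightarrow> real^'m^'n \<Rightarrow> real^'m \<Rightarrow>
   real^'n^'n \<Rightarrow> real^('h \<times> 'n)^('h \<times> 'n) \<Rightarrow> real^('h \<times> 'm)^('h \<times> 'm) \<Rightarrow>
   (nat \<Rightarrow> 'a \<Rightarrow> real^'n) \<Rightarrow> (nat \<Rightarrow> 'm::finite \<Rightarrow> 'a \<Rightarrow> bool) \<Rightarrow> nat \<Rightarrow>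
   (('a \<Rightarrow> real^('h \<times> 'm)) \<Rightarrow> 'a \<Rightarrow> real^('h::{finite,linorder} \<times> 'n)) \<Rightarrow>
   ('a \<Rightarrow> real^('h \<times> 'm)) \<Rightarrow> 'a \<Rightarrow> real" where
  "running_cost A B \<mu> Q \<Omega> \<Psi> X L k err U \<omega> =
     X k \<omega> \<bullet> (Q *v X k \<omega>)
     + predicted_state A B \<mu> X k U \<omega> \<bullet> (\<Omega> *v predicted_state A B \<mu> X k U \<omega>)
     + err U \<omega> \<bullet> (\<Omega> *v err U \<omega>)
     + U \<omega> \<bullet> ((transpose (Ups L k \<omega>) ** \<Psi> ** Ups L k \<omega>) *v U \<omega>)"

text \<open>
  \<open>J\<close> is (a version of) the minimum over all \<open>I\<close>-measurable \<open>U\<close> of the conditional expectation of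
  \<open>c U\<close> given \<open>I\<close>: it is attained by some \<open>U\<close> and is a lower bound for every \<open>U\<close>, almost surely.
  No integrability of \<open>U\<close> is required.  For nonnegative integrands \<open>real_cond_exp\<close> is the (truncated
  to the reals) extended-valued conditional expectation, and for the quadratic cost above the latter
  is almost surely finite, as \<open>U\<close> is \<open>I\<close>-measurable.
\<close>

definition is_min_cond_cost ::
  "'a measure \<Rightarrow> 'a measure \<Rightarrow> (('a \<Rightarrow> real^'d) \<Rightarrow> 'a \<Rightarrow> real) \<Rightarrow> ('a \<Rightarrow> real) \<Rightarrow> bool" where
  "is_min_cond_cost M I c J \<longleftrightarrow> J \<in> borel_measurable I \<and>
     (\<exists>U \<in> borel_measurable I. AE \<omega> in M. J \<omega> = real_cond_exp M I (c U) \<omega>) \<and>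
     (\<forall>U \<in> borel_measurable I. AE \<omega> in M. J \<omega> \<le> real_cond_exp M I (c U) \<omega>)"

definition min_cond_cost ::
  "'a measure \<Rightarrow> 'a measure \<Rightarrow> (('a \<Rightarrow> real^'d) \<Rightarrow> 'a \<Rightarrow> real) \<Rightarrow> 'a \<Rightarrow> real" where
  "min_cond_cost M I c = (SOME J. is_min_cond_cost M I c J)"

definition Jstar_tcp ::
  "'a measure \<Rightarrow> real^'n^'n \<Rightarrow> real^'m^'n \<Rightarrow> real^'m \<Rightarrow>
   real^'n^'n \<Rightarrow> real^('h::{finite,linorder} \<times> 'n)^('h \<times> 'n) \<Rightarrow> real^('h \<times> 'm)^('h \<times> 'm) \<Rightarrow>
   (nat \<Rightarrow> 'a \<Rightarrow> real^'n) \<Rightarrow> (nat \<Rightarrow> 'a \<Rightarrow> real^'n) \<Rightarrow> (nat \<Rightarrow> 'm::finite \<Rightarrow> 'a \<Rightarrow> bool) \<Rightarrow> nat \<Rightarrow>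
   'a \<Rightarrow> real" where
  "Jstar_tcp M A B \<mu> Q \<Omega> \<Psi> X W L k = min_cond_cost M (info_tcp M X L k)
     (running_cost A B \<mu> Q \<Omega> \<Psi> X L k (error_tcp M A B X W L k))"

definition Jstar_udp ::
  "'a measure \<Rightarrow> real^'n^'n \<Rightarrow> real^'m^'n \<Rightarrow> real^'m \<Rightarrow>
   real^'n^'n \<Rightarrow> real^('h::{finite,linorder} \<times> 'n)^('h \<times> 'n) \<Rightarrow> real^('h \<times> 'm)^('h \<times> 'm) \<Rightarrow>
   (nat \<Rightarrow> 'a \<Rightarrow> real^'n) \<Rightarrow> (nat \<Rightarrow> 'a \<Rightarrow> real^'n) \<Rightarrow> (nat \<Rightarrow> 'm::finite \<Rightarrow> 'a \<Rightarrow> bool) \<Rightarrow> nat \<Rightarrow>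
   'a \<Rightarrow> real" where
  "Jstar_udp M A B \<mu> Q \<Omega> \<Psi> X W L k = min_cond_cost M (info_udp M X k)
     (running_cost A B \<mu> Q \<Omega> \<Psi> X L k (error_udp M A B X W L k))"

end

theory Submission
  imports Defs
begin

text \<open>
  Given the information, both conditional costs are the same strictly convex quadratic function of the
  input, up to one extra term for UDP: the conditional covariance of the error contributes
  \<open>\<Sum>p. \<kappa> p * \<mu> p * (1 - \<mu> p) * (u p)\<^sup>2\<close>, where \<open>\<kappa>\<close> is the diagonal of \<open>\<Gamma>\<^sup>T \<Omega> \<Gamma>\<close>; all cross terms vanish by
  independence. The minimizers are linear in the state, hence measurable, so the minima are attained
  pointwise. Evaluating the TCP cost at the UDP minimizer \<open>u\<close> shows that the gap is at least the extra term
  at \<open>u\<close>. If that term vanishes, then \<open>\<Gamma> u = 0\<close>, and the stationarity equation for \<open>u\<close> forces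
  \<open>\<Gamma>\<^sup>T \<Omega> \<Phi> x = 0\<close>, an event of probability zero for a nondegenerate Gaussian state \<open>x\<close>.
\<close>

section \<open>Quadratic costs\<close>

text \<open>The two costs are conditioned on different sigma-algebras and minimized over different
  classes of inputs, so an inclusion between these classes does not compare them. They become
  comparable because noise and channel outcomes from time \<open>k\<close> on are independent of
  either information set: each conditional cost, as a function of the input value, then depends on
  the information only through \<open>X k\<close>, and a linear feedback of \<open>X k\<close> is
  admissible in both problems. Two obstacles shape the rest. Inputs are only measurable, so the
  terms of the expanded cost need not have finite mean, and linearity of conditional expectation has
  to be secured for them separately (\<open>cond_mean\<close>). Moreover
  \<open>min_cond_cost\<close> is an arbitrary choice among versions, so it must be shown to be
  determined almost surely before anything can be compared
  (\<open>min_cond_cost_AE\<close>).\<close>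

lemma inner_matrix_vector_mult:
  fixes A :: "real^'n^'m"
  shows "x \<bullet> (A *v y) = (transpose A *v x) \<bullet> y"
  by (simp add: dot_lmul_matrix transpose_matrix_vector)

lemma inner_congruence:
  fixes G :: "real^'m^'r" and H :: "real^'n^'r"
  shows "(H *v a) \<bullet> (S *v (G *v b)) = a \<bullet> ((transpose H ** S ** G) *v b)"
  by (simp only: matrix_vector_mul_assoc[symmetric] inner_matrix_vector_mult[of a "transpose H"] transpose_transpose)

lemma inner_matrix_vector_mult_sum:
  fixes S :: "real^'n^'m"
  shows "x \<bullet> (S *v y) = (\<Sum>p\<in>UNIV. \<Sum>q\<in>UNIV. (x $ p * y $ q) * S $ p $ q)"
  by (simp add: inner_vec_def matrix_vector_mult_def sum_distrib_left ac_simps)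

lemma quadratic_form_add:
  fixes S :: "real^'n^'n"
  assumes "transpose S = S"
  shows "(a + b) \<bullet> (S *v (a + b)) = a \<bullet> (S *v a) + 2 * (b \<bullet> (S *v a)) + b \<bullet> (S *v b)"
proof -
  have "a \<bullet> (S *v b) = b \<bullet> (S *v a)"
    using inner_matrix_vector_mult[of a S b] assms by (simp add: inner_commute)
  then show ?thesis by (simp add: matrix_vector_right_distrib inner_add_left inner_add_right)
qed

lemma pos_definite_nonneg: "pos_definite S \<Longrightarrow> 0 \<le> x \<bullet> (S *v x)"
  unfolding pos_definite_def by (cases "x = 0") (auto intro: less_imp_le)

lemma pos_definite_sym: "pos_definite S \<Longrightarrow> transpose S = S"
  unfolding pos_definite_def by simp

lemma pos_definite_eq_0_iff: "pos_definite S \<Longrightarrow> x \<bullet> (S *v x) = 0 \<longleftrightarrow> x = 0"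
  unfolding pos_definite_def by (metis inner_zero_left less_irrefl)

lemma matrix_entry_axis:
  fixes S :: "real^'n^'m"
  shows "S $ i $ j = axis i 1 \<bullet> (S *v axis j 1)"
  by (simp add: matrix_vector_mult_basis inner_axis' column_def)

lemma pos_definite_diagonal_entry: "pos_definite S \<Longrightarrow> 0 < S $ i $ i"
  unfolding pos_definite_def matrix_entry_axis by (simp add: axis_eq_0_iff)

lemma diag_mult_vec: "diag d *v u = (\<chi> p. d $ p * u $ p)"
  by (simp add: diag_def matrix_vector_mult_def vec_eq_iff if_distrib[where f = "\<lambda>x. x * _"] cong: if_cong)

lemma is_diagonal_eq_diag: "is_diagonal S \<Longrightarrow> S = diag (\<chi> i. S $ i $ i)"
  by (simp add: is_diagonal_def diag_def vec_eq_iff)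

text \<open>The common shape of both conditional costs: \<open>P *v x + G *v u\<close> is the
  predicted trajectory and \<open>d\<close> an effective diagonal input weight. The protocols differ
  only in \<open>d\<close>.\<close>

definition quad_cost ::
  "real^'r^'r \<Rightarrow> real^'n^'r \<Rightarrow> real^'p^'r \<Rightarrow> real^'p \<Rightarrow> real^'n \<Rightarrow> real^'p \<Rightarrow> real" where
  "quad_cost S P G d x u = (P *v x + G *v u) \<bullet> (S *v (P *v x + G *v u)) + (\<Sum>p\<in>UNIV. d $ p * (u $ p)\<^sup>2)"

text \<open>The Hessian \<open>transpose G ** S ** G + diag d\<close> (up to a factor 2) is positive
  definite, hence invertible, so the gradient equation has a solution linear in \<open>x\<close>;
  completing the square around it gives minimality. The gradient equation itself is exported because
  the strictness argument in \<open>quad_cost_min_gap\<close> needs it.\<close>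

lemma quad_cost_linear_minimizer:
  fixes S :: "real^'r^'r" and P :: "real^'n^'r" and G :: "real^'p^'r"
  assumes S: "pos_definite S" and d: "\<And>p. 0 < d $ p"
  obtains K :: "real^'n^'p" where
    "\<And>x. transpose G *v (S *v (P *v x + G *v (K *v x))) + diag d *v (K *v x) = 0"
    "\<And>x u. quad_cost S P G d x (K *v x) \<le> quad_cost S P G d x u"
proof -
  define H where "H = transpose G ** S ** G + diag d"
  have Hq: "u \<bullet> (H *v u) = (G *v u) \<bullet> (S *v (G *v u)) + (\<Sum>p\<in>UNIV. d $ p * (u $ p)\<^sup>2)" for u
  proof -
    have "u \<bullet> (transpose G *v (S *v (G *v u))) = (G *v u) \<bullet> (S *v (G *v u))"
      by (simp only: inner_matrix_vector_mult[of u "transpose G"] transpose_transpose)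
    then show ?thesis
      by (simp add: H_def matrix_vector_mult_add_rdistrib inner_add_right
        diag_mult_vec inner_vec_def[of u "vec_lambda _"] power2_eq_square ac_simps
        flip: matrix_vector_mul_assoc)
  qed
  have "u = 0" if "H *v u = 0" for u
  proof -
    have "(\<Sum>p\<in>UNIV. d $ p * (u $ p)\<^sup>2) \<le> 0"
      using Hq[of u] that pos_definite_nonneg[OF S, of "G *v u"] by simp
    moreover have "0 \<le> d $ p * (u $ p)\<^sup>2" for p using d[of p] by simp
    ultimately have "\<forall>p\<in>UNIV. d $ p * (u $ p)\<^sup>2 = 0"
      by (subst sum_nonneg_eq_0_iff[symmetric]) (auto intro: order_antisym sum_nonneg)
    then show "u = 0" using d by (simp add: vec_eq_iff) (metis less_irrefl)
  qed
  then obtain H' where H': "H' ** H = mat 1"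
    using matrix_left_invertible_ker[of H] by blast
  then have HH': "H ** H' = mat 1" by (simp add: matrix_left_right_inverse)
  \<comment> \<open>Solves \<open>(transpose G ** S ** P) *v x + H *v v = 0\<close> for
    \<open>v\<close>; this is half the gradient set to zero.\<close>
  define K where "K = (-1) *\<^sub>R (H' ** (transpose G ** S ** P))"
  have grad: "transpose G *v (S *v (P *v x + G *v (K *v x))) + diag d *v (K *v x) = 0" for x
  proof -
    have "transpose G *v (S *v (P *v x + G *v v)) + diag d *v v
        = (transpose G ** S ** P) *v x + H *v v" for v
      by (simp add: H_def matrix_vector_mult_add_rdistrib matrix_vector_right_distrib
          flip: matrix_vector_mul_assoc)
    moreover have "H *v (K *v x) = (-1) *\<^sub>R ((H ** H') *v ((transpose G ** S ** P) *v x))"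
      by (simp only: K_def scaleR_matrix_vector_assoc[symmetric] matrix_vector_mult_scaleR
          matrix_vector_mul_assoc matrix_mul_assoc)
    ultimately show ?thesis by (simp add: HH')
  qed
  moreover have "quad_cost S P G d x (K *v x) \<le> quad_cost S P G d x u" for x u
  proof -
    define v w where "v = K *v x" and "w = u - v"
    have u: "u = v + w" by (simp add: w_def)
    have sq: "d $ p * ((v + w) $ p)\<^sup>2 = d $ p * (v $ p)\<^sup>2 + 2 * (w $ p * (diag d *v v) $ p) + d $ p * (w $ p)\<^sup>2" for p
      by (simp add: diag_mult_vec power2_eq_square algebra_simps)
    have "P *v x + G *v (v + w) = (P *v x + G *v v) + G *v w"
      by (simp add: matrix_vector_right_distrib)
    \<comment> \<open>Exact second-order expansion at \<open>v\<close>: the middle line is the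
      derivative in direction \<open>w\<close>, which \<open>grad\<close> kills, and the last line
      is nonnegative.\<close>
    then have "quad_cost S P G d x u = quad_cost S P G d x v
        + 2 * ((G *v w) \<bullet> (S *v (P *v x + G *v v)) + w \<bullet> (diag d *v v))
        + ((G *v w) \<bullet> (S *v (G *v w)) + (\<Sum>p\<in>UNIV. d $ p * (w $ p)\<^sup>2))"
      unfolding quad_cost_def u sq
      by (simp only: quadratic_form_add[OF pos_definite_sym[OF S]])
        (simp add: sum.distrib inner_vec_def[of w] sum_distrib_left)
    also have "(G *v w) \<bullet> (S *v (P *v x + G *v v)) + w \<bullet> (diag d *v v)
        = w \<bullet> (transpose G *v (S *v (P *v x + G *v v)) + diag d *v v)"
      by (simp only: inner_add_right inner_matrix_vector_mult[of w "transpose G"] transpose_transpose)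
    also have "\<dots> = 0" using grad[of x] by (simp add: v_def)
    finally show ?thesis
      using pos_definite_nonneg[OF S, of "G *v w"] d
      by (simp add: v_def sum_nonneg less_imp_le)
  qed
  ultimately show ?thesis using that by blast
qed

lemma quad_cost_min_gap:
  fixes S :: "real^'r^'r" and P :: "real^'n^'r" and \<Gamma> :: "real^'p^'r"
  defines "\<kappa> \<equiv> \<lambda>p. (transpose \<Gamma> ** S ** \<Gamma>) $ p $ p"
  assumes S: "pos_definite S"
    and \<nu>: "\<And>p. 0 < \<nu> $ p" "\<And>p. \<nu> $ p < 1"
    and d': "\<And>p. d' $ p = d $ p + \<kappa> p * (\<nu> $ p * (1 - \<nu> $ p))"
    and x: "(transpose \<Gamma> ** S ** P) *v x \<noteq> 0"
    and v: "\<And>u. quad_cost S P (\<Gamma> ** diag \<nu>) d x v \<le> quad_cost S P (\<Gamma> ** diag \<nu>) d x u"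
    and w: "transpose (\<Gamma> ** diag \<nu>) *v (S *v (P *v x + (\<Gamma> ** diag \<nu>) *v w)) + diag d' *v w = 0"
  shows "quad_cost S P (\<Gamma> ** diag \<nu>) d x v < quad_cost S P (\<Gamma> ** diag \<nu>) d' x w"
proof -
  let ?G = "\<Gamma> ** diag \<nu>"
  have tr: "(transpose \<Gamma> *v y) $ p = column p \<Gamma> \<bullet> y" for p y
    by (simp add: matrix_vector_mult_def transpose_def column_def inner_vec_def)
  have \<kappa>: "\<kappa> p = column p \<Gamma> \<bullet> (S *v column p \<Gamma>)" for p
  proof -
    have "\<kappa> p = axis p 1 \<bullet> (transpose \<Gamma> *v (S *v (\<Gamma> *v axis p 1)))"
      by (simp only: \<kappa>_def matrix_entry_axis matrix_vector_mul_assoc matrix_mul_assoc)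
    then show ?thesis
      by (simp add: inner_axis' tr matrix_vector_mult_basis del: transpose_matrix_vector)
  qed
  have \<kappa>_nonneg: "0 \<le> \<kappa> p" for p unfolding \<kappa> by (rule pos_definite_nonneg[OF S])
  have "\<exists>p. \<kappa> p * (w $ p)\<^sup>2 \<noteq> 0"
  proof (rule ccontr)
    assume "\<not> ?thesis"
    then have zero: "column p \<Gamma> = 0 \<or> w $ p = 0" for p
      using pos_definite_eq_0_iff[OF S] by (auto simp: \<kappa>)
    have "\<Gamma> *v (diag \<nu> *v w) = 0"
      unfolding matrix_mult_sum[of \<Gamma>] by (rule sum.neutral) (use zero in \<open>auto simp: diag_mult_vec\<close>)
    then have Gw: "?G *v w = 0" by (simp add: matrix_vector_mul_assoc)
    have "((transpose \<Gamma> ** S ** P) *v x) $ p = 0" for p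
    proof (cases "column p \<Gamma> = 0")
      case True
      then show ?thesis by (simp add: tr del: transpose_matrix_vector flip: matrix_vector_mul_assoc)
    next
      case False
      then have "w $ p = 0" using zero by blast
      have "transpose (diag \<nu>) = diag \<nu>" by (simp add: transpose_def diag_def vec_eq_iff)
      then have "\<nu> $ p * (transpose \<Gamma> *v (S *v (P *v x))) $ p + d' $ p * w $ p = 0"
        using arg_cong[OF w[unfolded Gw], of "\<lambda>z. z $ p"]
        by (simp add: matrix_transpose_mul diag_mult_vec flip: matrix_vector_mul_assoc)
      then show ?thesis using \<open>w $ p = 0\<close> \<nu>(1)[of p] by (simp flip: matrix_vector_mul_assoc)
    qed
    then show False using x by (simp add: vec_eq_iff)
  qed
  then obtain p where p: "\<kappa> p * (w $ p)\<^sup>2 \<noteq> 0" by blast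
  have nonneg: "0 \<le> \<kappa> q * (\<nu> $ q * (1 - \<nu> $ q)) * (w $ q)\<^sup>2" for q
    using \<kappa>_nonneg[of q] \<nu>[of q] by simp
  moreover have "\<kappa> p * (\<nu> $ p * (1 - \<nu> $ p)) * (w $ p)\<^sup>2 \<noteq> 0"
    using p \<nu>[of p] by simp
  ultimately have "0 < (\<Sum>q\<in>UNIV. \<kappa> q * (\<nu> $ q * (1 - \<nu> $ q)) * (w $ q)\<^sup>2)"
    by (intro sum_pos2[of _ p]) (auto simp: less_le)
  moreover have "quad_cost S P ?G d' x w
      = quad_cost S P ?G d x w + (\<Sum>q\<in>UNIV. \<kappa> q * (\<nu> $ q * (1 - \<nu> $ q)) * (w $ q)\<^sup>2)"
    by (simp add: quad_cost_def d' distrib_right sum.distrib)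
  ultimately show ?thesis using v[of w] by simp
qed

section \<open>Conditional expectation without integrability\<close>

text \<open>
  A positive \<open>F\<close>-measurable weight \<open>b\<close> that makes \<open>b f\<close> integrable replaces integrability of \<open>f\<close>:
  no integrability is known for the inputs.
\<close>

definition cond_mean :: "'a measure \<Rightarrow> 'a measure \<Rightarrow> ('a \<Rightarrow> real) \<Rightarrow> ('a \<Rightarrow> real) \<Rightarrow> bool" where
  "cond_mean M F f g \<longleftrightarrow> f \<in> borel_measurable M \<and> g \<in> borel_measurable F \<and>
     (\<exists>b \<in> borel_measurable F. (\<forall>\<omega>. 0 < b \<omega> \<and> b \<omega> \<le> 1) \<and> integrable M (\<lambda>\<omega>. b \<omega> * f \<omega>) \<and>
        (AE \<omega> in M. real_cond_exp M F (\<lambda>\<omega>. b \<omega> * f \<omega>) \<omega> = b \<omega> * g \<omega>))"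

lemma integrable_mult_squares:
  fixes f g :: "'a \<Rightarrow> real"
  assumes "integrable M (\<lambda>\<omega>. (f \<omega>)\<^sup>2)" "integrable M (\<lambda>\<omega>. (g \<omega>)\<^sup>2)"
    and [measurable]: "f \<in> borel_measurable M" "g \<in> borel_measurable M"
  shows "integrable M (\<lambda>\<omega>. f \<omega> * g \<omega>)"
proof (rule Bochner_Integration.integrable_bound)
  show "integrable M (\<lambda>\<omega>. (f \<omega>)\<^sup>2 + (g \<omega>)\<^sup>2)" using assms by simp
  have "\<bar>x * y\<bar> \<le> x\<^sup>2 + y\<^sup>2" for x y :: real
    using sum_squares_bound[of "\<bar>x\<bar>" "\<bar>y\<bar>"] mult_nonneg_nonneg[OF abs_ge_zero[of x] abs_ge_zero[of y]]
    unfolding abs_mult power2_abs by linarith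
  then show "AE \<omega> in M. norm (f \<omega> * g \<omega>) \<le> norm ((f \<omega>)\<^sup>2 + (g \<omega>)\<^sup>2)"
    by (intro AE_I2) simp
qed simp

lemma integrable_mult_bounded:
  fixes f g :: "'a \<Rightarrow> real"
  assumes "integrable M f" "g \<in> borel_measurable M" "\<And>\<omega>. \<bar>g \<omega>\<bar> \<le> 1"
  shows "integrable M (\<lambda>\<omega>. g \<omega> * f \<omega>)"
  using assms by (intro Bochner_Integration.integrable_bound[OF assms(1)])
    (auto simp: abs_mult intro!: AE_I2 mult_left_le_one_le)

context finite_measure_subalgebra
begin

lemma borel_measurable_sub: "f \<in> borel_measurable F \<Longrightarrow> f \<in> borel_measurable M"
  using measurable_from_subalg[OF subalg] .

text \<open>\<open>real_cond_exp\<close> is a difference of two extended-valued conditional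
  expectations. A nonnegative factor keeps positive and negative parts apart, so it can be pulled
  out of each of them, with no integrability of \<open>f\<close>.\<close>

lemma real_cond_exp_mult_nonneg:
  assumes [measurable]: "b \<in> borel_measurable F" "f \<in> borel_measurable M" and b: "\<And>\<omega>. 0 \<le> b \<omega>"
  shows "AE \<omega> in M. real_cond_exp M F (\<lambda>\<omega>. b \<omega> * f \<omega>) \<omega> = b \<omega> * real_cond_exp M F f \<omega>"
proof -
  have *: "AE \<omega> in M. ennreal (b \<omega>) * nn_cond_exp M F (\<lambda>\<omega>. ennreal (h \<omega>)) \<omega>
      = nn_cond_exp M F (\<lambda>\<omega>. ennreal (b \<omega> * h \<omega>)) \<omega>" if [measurable]: "h \<in> borel_measurable M" for h
    using nn_cond_exp_prod[of "\<lambda>\<omega>. ennreal (b \<omega>)" "\<lambda>\<omega>. ennreal (h \<omega>)"] b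
    by (simp add: ennreal_mult')
  from *[of f] *[of "\<lambda>\<omega>. - f \<omega>"]
  have "AE \<omega> in M. ennreal (b \<omega>) * nn_cond_exp M F (\<lambda>\<omega>. ennreal (f \<omega>)) \<omega>
      = nn_cond_exp M F (\<lambda>\<omega>. ennreal (b \<omega> * f \<omega>)) \<omega>"
    "AE \<omega> in M. ennreal (b \<omega>) * nn_cond_exp M F (\<lambda>\<omega>. ennreal (- f \<omega>)) \<omega>
      = nn_cond_exp M F (\<lambda>\<omega>. ennreal (- (b \<omega> * f \<omega>))) \<omega>"
    by simp_all
  then show ?thesis
  proof eventually_elim
    case (elim \<omega>)
    then show ?case
      unfolding real_cond_exp_def using b[of \<omega>]
      by (simp add: elim[symmetric] enn2real_mult right_diff_distrib)
  qed
qed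

text \<open>The weight can be pulled out and, being positive, cancelled. This leads back from
  weighted functions to the \<open>real_cond_exp\<close> that occurs in the costs.\<close>

lemma cond_meanD:
  assumes "cond_mean M F f g"
  shows "AE \<omega> in M. real_cond_exp M F f \<omega> = g \<omega>"
proof -
  from assms obtain b where b: "b \<in> borel_measurable F" "\<And>\<omega>. 0 < b \<omega>"
    "AE \<omega> in M. real_cond_exp M F (\<lambda>\<omega>. b \<omega> * f \<omega>) \<omega> = b \<omega> * g \<omega>" "f \<in> borel_measurable M"
    unfolding cond_mean_def by blast
  from b(3) real_cond_exp_mult_nonneg[OF b(1,4) less_imp_le[OF b(2)]] show ?thesis
  proof eventually_elim
    case (elim \<omega>)
    then show ?case using b(2)[of \<omega>] by simp
  qed
qed

lemma cond_mean_integrable: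
  assumes "integrable M f" "g \<in> borel_measurable F" "AE \<omega> in M. real_cond_exp M F f \<omega> = g \<omega>"
  shows "cond_mean M F f g"
  unfolding cond_mean_def using assms by (auto intro!: bexI[of _ "\<lambda>_. 1"])

text \<open>Dividing the weight by \<open>1 + \<bar>g \<omega>\<bar>\<close> absorbs an arbitrarily
  large \<open>g\<close>: the weighted product becomes the integrable
  \<open>b \<omega> * f \<omega>\<close> times a factor bounded by 1.\<close>

lemma cond_mean_scale:
  assumes "cond_mean M F f f'" and [measurable]: "g \<in> borel_measurable F"
  shows "cond_mean M F (\<lambda>\<omega>. g \<omega> * f \<omega>) (\<lambda>\<omega>. g \<omega> * f' \<omega>)"
proof -
  from assms obtain b where [measurable]: "b \<in> borel_measurable F"
    and b: "\<And>\<omega>. 0 < b \<omega>" "\<And>\<omega>. b \<omega> \<le> 1" "integrable M (\<lambda>\<omega>. b \<omega> * f \<omega>)"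
    "AE \<omega> in M. real_cond_exp M F (\<lambda>\<omega>. b \<omega> * f \<omega>) \<omega> = b \<omega> * f' \<omega>"
    and [measurable]: "f \<in> borel_measurable M" "f' \<in> borel_measurable F"
    unfolding cond_mean_def by blast
  note [measurable] = borel_measurable_sub[of g]  borel_measurable_sub[of b]
  let ?c = "\<lambda>\<omega>. g \<omega> / (1 + \<bar>g \<omega>\<bar>)" and ?b = "\<lambda>\<omega>. b \<omega> / (1 + \<bar>g \<omega>\<bar>)"
  have eq: "?b \<omega> * (g \<omega> * f \<omega>) = ?c \<omega> * (b \<omega> * f \<omega>)" for \<omega> by simp
  have int: "integrable M (\<lambda>\<omega>. ?c \<omega> * (b \<omega> * f \<omega>))"
    by (rule integrable_mult_bounded[OF b(3)]) (auto simp: field_simps)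
  have "0 < ?b \<omega>" "?b \<omega> \<le> 1" for \<omega>
    using b(1,2)[of \<omega>] abs_ge_zero[of "g \<omega>"] by (auto simp: divide_simps)
  moreover have "AE \<omega> in M. real_cond_exp M F (\<lambda>\<omega>. ?c \<omega> * (b \<omega> * f \<omega>)) \<omega> = ?b \<omega> * (g \<omega> * f' \<omega>)"
    using real_cond_exp_mult[OF _ _ int] b(4) by (force elim: eventually_elim2)
  moreover have "?b \<in> borel_measurable F" "(\<lambda>\<omega>. g \<omega> * f \<omega>) \<in> borel_measurable M"
    "(\<lambda>\<omega>. g \<omega> * f' \<omega>) \<in> borel_measurable F" by measurable
  ultimately show ?thesis
    unfolding cond_mean_def using int eq by (intro conjI bexI[of _ ?b]) presburger+
qed

text \<open>The product of the two weights serves both summands; the bound by 1 in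
  \<open>cond_mean\<close> is what keeps each summand integrable under the other's weight.\<close>

lemma cond_mean_add:
  assumes "cond_mean M F f f'" "cond_mean M F g g'"
  shows "cond_mean M F (\<lambda>\<omega>. f \<omega> + g \<omega>) (\<lambda>\<omega>. f' \<omega> + g' \<omega>)"
proof -
  from assms obtain b c where [measurable]: "b \<in> borel_measurable F" "c \<in> borel_measurable F"
    and b: "\<And>\<omega>. 0 < b \<omega>" "\<And>\<omega>. b \<omega> \<le> 1" "integrable M (\<lambda>\<omega>. b \<omega> * f \<omega>)"
    "AE \<omega> in M. real_cond_exp M F (\<lambda>\<omega>. b \<omega> * f \<omega>) \<omega> = b \<omega> * f' \<omega>"
    and c: "\<And>\<omega>. 0 < c \<omega>" "\<And>\<omega>. c \<omega> \<le> 1" "integrable M (\<lambda>\<omega>. c \<omega> * g \<omega>)"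
    "AE \<omega> in M. real_cond_exp M F (\<lambda>\<omega>. c \<omega> * g \<omega>) \<omega> = c \<omega> * g' \<omega>"
    and [measurable]: "f \<in> borel_measurable M" "f' \<in> borel_measurable F"
      "g \<in> borel_measurable M" "g' \<in> borel_measurable F"
    unfolding cond_mean_def by blast
  note [measurable] = borel_measurable_sub[of b] borel_measurable_sub[of c]
  let ?f = "\<lambda>\<omega>. c \<omega> * (b \<omega> * f \<omega>)" and ?g = "\<lambda>\<omega>. b \<omega> * (c \<omega> * g \<omega>)"
  have eq: "(b \<omega> * c \<omega>) * (f \<omega> + g \<omega>) = ?f \<omega> + ?g \<omega>" for \<omega> by (simp add: algebra_simps)
  have int: "integrable M ?f" "integrable M ?g"
    using less_imp_le[OF b(1)] less_imp_le[OF c(1)] b(2) c(2)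
    by (auto intro!: integrable_mult_bounded b(3) c(3))
  have "AE \<omega> in M. real_cond_exp M F (\<lambda>\<omega>. ?f \<omega> + ?g \<omega>) \<omega> = (b \<omega> * c \<omega>) * (f' \<omega> + g' \<omega>)"
  proof -
    have "AE \<omega> in M. real_cond_exp M F ?f \<omega> = c \<omega> * real_cond_exp M F (\<lambda>\<omega>. b \<omega> * f \<omega>) \<omega>"
      "AE \<omega> in M. real_cond_exp M F ?g \<omega> = b \<omega> * real_cond_exp M F (\<lambda>\<omega>. c \<omega> * g \<omega>) \<omega>"
      using real_cond_exp_mult[OF _ _ int(1)] real_cond_exp_mult[OF _ _ int(2)] by simp_all
    with real_cond_exp_add[OF int] b(4) c(4) show ?thesis
      by eventually_elim (simp add: algebra_simps)
  qed
  moreover have "0 < b \<omega> * c \<omega>" "b \<omega> * c \<omega> \<le> 1" for \<omega>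
    using b(1,2)[of \<omega>] c(1,2)[of \<omega>] by (auto intro: mult_le_one less_imp_le)
  moreover have "(\<lambda>\<omega>. b \<omega> * c \<omega>) \<in> borel_measurable F" "(\<lambda>\<omega>. f \<omega> + g \<omega>) \<in> borel_measurable M"
    "(\<lambda>\<omega>. f' \<omega> + g' \<omega>) \<in> borel_measurable F" by measurable
  moreover have "integrable M (\<lambda>\<omega>. ?f \<omega> + ?g \<omega>)"
    using int by (rule Bochner_Integration.integrable_add)
  ultimately show ?thesis
    unfolding cond_mean_def using eq by (intro conjI bexI[of _ "\<lambda>\<omega>. b \<omega> * c \<omega>"]) presburger+
qed

text \<open>Scale the constant function 1, which is integrable, by \<open>g\<close>; no moment of
  \<open>g\<close> is involved.\<close>

lemma cond_mean_measurable:
  assumes [measurable]: "g \<in> borel_measurable F"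
  shows "cond_mean M F g g"
proof -
  have "AE \<omega> in M. real_cond_exp M F (\<lambda>_. 1) \<omega> = 1"
    by (rule real_cond_exp_F_meas) auto
  then show ?thesis
    using cond_mean_scale[OF cond_mean_integrable[of "\<lambda>_. 1" "\<lambda>_. 1"] assms] by simp
qed

lemma cond_mean_sum:
  assumes "\<And>i. i \<in> J \<Longrightarrow> cond_mean M F (f i) (g i)"
  shows "cond_mean M F (\<lambda>\<omega>. \<Sum>i\<in>J. f i \<omega>) (\<lambda>\<omega>. \<Sum>i\<in>J. g i \<omega>)"
  using assms
  by (induction J rule: infinite_finite_induct)
    (simp_all add: cond_mean_measurable cond_mean_add)

end

section \<open>Independence of disjoint groups of sources\<close>

lemma (in prob_space) indep_sources_mult:
  fixes f g :: "'a \<Rightarrow> real"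
  assumes E: "indep_sets E UNIV" and stable: "\<And>i. Int_stable (E i)"
    and disj: "S \<inter> T = {}"
    and f: "f \<in> borel_measurable (sigma (space M) (\<Union>i\<in>S. E i))"
    and g: "g \<in> borel_measurable (sigma (space M) (\<Union>i\<in>T. E i))"
    and int: "integrable M f" "integrable M g"
  shows "integrable M (\<lambda>\<omega>. f \<omega> * g \<omega>)" "expectation (\<lambda>\<omega>. f \<omega> * g \<omega>) = expectation f * expectation g"
proof -
  have ev: "E i \<subseteq> events" for i using E by (auto simp: indep_sets_def)
  then have sp: "(\<Union>i\<in>R. E i) \<subseteq> Pow (space M)" for R
    using sets.sets_into_space by blast
  \<comment> \<open>\<open>case_bool S T\<close> turns the two groups into a family indexed by
    \<open>bool\<close>; since each source is a pi-system, the sigma-algebras generated by disjoint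
    groups are independent.\<close>
  have "indep_sets (\<lambda>j. sigma_sets (space M) (\<Union>i\<in>case_bool S T j. E i)) UNIV"
    by (rule indep_sets_collect_sigma)
      (use indep_sets_mono_index[OF subset_UNIV E] stable disj in
        \<open>auto simp: disjoint_family_on_def split: bool.split\<close>)
  moreover have "(\<lambda>j. sigma_sets (space M) (\<Union>i\<in>case_bool S T j. E i))
     = case_bool (sigma_sets (space M) (\<Union>i\<in>S. E i)) (sigma_sets (space M) (\<Union>i\<in>T. E i))"
    by (auto simp: fun_eq_iff split: bool.split)
  ultimately have ind: "indep_set (sigma_sets (space M) (\<Union>i\<in>S. E i)) (sigma_sets (space M) (\<Union>i\<in>T. E i))"
    unfolding indep_set_def by simp
  have pre: "sigma_sets (space M) {h -` A \<inter> space M | A. A \<in> sets borel} \<subseteq> sigma_sets (space M) (\<Union>i\<in>R. E i)"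
    if "h \<in> borel_measurable (sigma (space M) (\<Union>i\<in>R. E i))" for h :: "'a \<Rightarrow> real" and R
    by (rule sigma_sets_mono) (use measurable_sets[OF that] sp[of R] in auto)
  have "indep_var borel f borel g"
    unfolding indep_var_eq
  proof (intro conjI)
    let ?P = "\<lambda>h :: 'a \<Rightarrow> real. sigma_sets (space M) {h -` A \<inter> space M | A. A \<in> sets borel}"
    have "indep_sets (case_bool (?P f) (?P g)) UNIV"
      by (rule indep_sets_mono_sets[OF ind[unfolded indep_set_def]])
        (use pre[OF f] pre[OF g] in \<open>auto split: bool.splits\<close>)
    then show "indep_set (?P f) (?P g)" unfolding indep_set_def .
  qed (use int in auto)
  from indep_var_integrable[OF this int] indep_var_lebesgue_integral[OF this int]
  show "integrable M (\<lambda>\<omega>. f \<omega> * g \<omega>)" "expectation (\<lambda>\<omega>. f \<omega> * g \<omega>) = expectation f * expectation g" .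
qed

text \<open>For \<open>A\<close> in \<open>I\<close>, the indicator of \<open>A\<close> and
  \<open>h\<close> are functions of disjoint groups of sources, so the integral of \<open>h\<close>
  over \<open>A\<close> factorizes; this is the characterizing property of a constant conditional
  expectation.\<close>

lemma (in prob_space) cond_mean_indep:
  fixes h :: "'a \<Rightarrow> real"
  assumes E: "indep_sets E UNIV" and stable: "\<And>i. Int_stable (E i)"
    and disj: "S \<inter> T = {}"
    and I: "subalgebra (sigma (space M) (\<Union>i\<in>S. E i)) I"
    and h: "h \<in> borel_measurable (sigma (space M) (\<Union>i\<in>T. E i))"
    and int: "integrable M h"
  shows "cond_mean M I h (\<lambda>_. expectation h)"
proof -
  have ev: "E i \<subseteq> events" for i using E by (auto simp: indep_sets_def)
  then have sub: "sets (sigma (space M) (\<Union>i\<in>S. E i)) \<subseteq> events"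
    by (auto intro!: sets.sigma_sets_subset simp: sets_measure_of_conv)
  have subI: "subalgebra M I" using I sub
    by (auto simp: subalgebra_def space_measure_of_conv)
  then interpret finite_measure_subalgebra M I by unfold_locales
  have "AE \<omega> in M. real_cond_exp M I h \<omega> = expectation h"
  proof (rule real_cond_exp_charact)
    fix A assume "A \<in> sets I"
    then have A: "A \<in> sets (sigma (space M) (\<Union>i\<in>S. E i))" "A \<in> events"
      using I subI by (auto simp: subalgebra_def)
    have "expectation (\<lambda>\<omega>. indicator A \<omega> * h \<omega>) = expectation (indicator A) * expectation h"
      by (rule indep_sources_mult(2)[OF E stable disj _ h _ int]) (use A in \<open>auto simp: emeasure_eq_measure\<close>)
    then show "(\<integral>\<omega>\<in>A. h \<omega> \<partial>M) = (\<integral>\<omega>\<in>A. expectation h \<partial>M)"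
      using A by (simp add: set_lebesgue_integral_def)
  qed (use int in auto)
  then show ?thesis by (intro cond_mean_integrable int) auto
qed

section \<open>Measurability and Gaussian vectors\<close>

lemma borel_measurable_vec_nth:
  fixes f :: "'a \<Rightarrow> 'c::euclidean_space^'n"
  assumes "f \<in> borel_measurable M"
  shows "(\<lambda>\<omega>. f \<omega> $ i) \<in> borel_measurable M"
  by (rule measurable_compose[OF assms borel_measurable_continuous_onI]) (intro linear_continuous_on bounded_linear_vec_nth)

lemma borel_measurable_vecI:
  fixes f :: "'a \<Rightarrow> 'c::euclidean_space^'n"
  assumes "\<And>i. (\<lambda>\<omega>. f \<omega> $ i) \<in> borel_measurable M"
  shows "f \<in> borel_measurable M"
proof (subst borel_measurable_euclidean_space, rule ballI)
  fix b :: "'c^'n" assume "b \<in> Basis"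
  then have "\<exists>i. \<exists>u\<in>Basis. b = axis i u" unfolding Basis_vec_def by simp
  then obtain i u where "b = axis i u" by blast
  then have "(\<lambda>\<omega>. f \<omega> \<bullet> b) = (\<lambda>\<omega>. f \<omega> $ i \<bullet> u)" by (simp add: inner_axis)
  then show "(\<lambda>\<omega>. f \<omega> \<bullet> b) \<in> borel_measurable M"
    using borel_measurable_inner[OF assms borel_measurable_const] by simp
qed

lemma borel_measurable_matrix_vector_mult:
  fixes A :: "real^'n^'m"
  assumes "f \<in> borel_measurable M"
  shows "(\<lambda>\<omega>. A *v f \<omega>) \<in> borel_measurable M"
  by (rule measurable_compose[OF assms borel_measurable_continuous_onI])
    (rule matrix_vector_mult_linear_continuous_on)

text \<open>A larger index has strictly more predecessors. Hence distinct stacked positions belong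
  to distinct pairs of time and channel, which is where independence over the horizon comes
  from.\<close>

lemma inj_blk: "inj (blk :: 'h::{finite,linorder} \<Rightarrow> nat)"
proof (rule linorder_injI)
  fix i j :: 'h assume "i < j"
  then have "{l. l < i} \<subset> {l. l < j}" by auto
  then have "blk i < blk j" unfolding blk_def by (intro psubset_card_mono) auto
  then show "blk i \<noteq> blk j" by simp
qed

lemma block_diag_diag: "block_diag (\<lambda>l. diag (d l)) = diag (\<chi> p. d (blk (fst p)) $ snd p)"
  by (auto simp: block_diag_def diag_def vec_eq_iff)

lemma Ups_mean_eq: "Ups_mean \<mu> = diag (\<chi> p. \<mu> $ snd p)"
  unfolding Ups_mean_def block_diag_diag ..

lemma Ups_eq: "Ups L k \<omega> = diag (\<chi> p. of_bool (L (k + blk (fst p)) (snd p) \<omega>))"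
  by (simp add: Ups_def Vmat_def block_diag_diag[of "\<lambda>l. \<chi> i. of_bool (L (k + l) i \<omega>)"])

section \<open>Sigma-algebras generated by preimages\<close>

lemma sigma_subalgebra:
  assumes "space N = S" "G \<subseteq> sets N"
  shows "subalgebra N (sigma S G)"
proof -
  have G: "G \<subseteq> Pow S" using assms sets.space_closed[of N] by blast
  have "sigma_sets S G \<subseteq> sets N" using sets.sigma_sets_subset[OF assms(2)] unfolding assms(1) .
  then show ?thesis
    unfolding subalgebra_def space_measure_of[OF G] sets_measure_of[OF G] assms(1) by blast
qed

lemma preimages_subset_sets:
  assumes "f \<in> measurable N N'" "space N = space M"
  shows "preimages M f N' \<subseteq> sets N"
  using measurable_sets[OF assms(1)] assms(2) by (auto simp: preimages_def)

lemma measurable_preimages: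
  assumes "space N = space M" "f \<in> space M \<rightarrow> space N'" "preimages M f N' \<subseteq> sets N"
  shows "f \<in> measurable N N'"
proof (rule measurableI)
  fix A assume "A \<in> sets N'"
  then have "f -` A \<inter> space N \<in> preimages M f N'" by (auto simp: preimages_def assms(1))
  then show "f -` A \<inter> space N \<in> sets N" using assms(3) by blast
qed (use assms(1,2) in auto)

lemma subalgebra_trans: "subalgebra M F \<Longrightarrow> subalgebra F G \<Longrightarrow> subalgebra M G"
  by (auto simp: subalgebra_def)

lemma (in finite_measure_subalgebra) cond_exp_vec_AE:
  assumes "\<And>i. cond_mean M F (\<lambda>\<omega>. Z \<omega> $ i) (\<lambda>\<omega>. Z' \<omega> $ i)"
  shows "AE \<omega> in M. cond_exp_vec M F Z \<omega> = Z' \<omega>"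
proof -
  have "AE \<omega> in M. \<forall>i. real_cond_exp M F (\<lambda>\<omega>'. Z \<omega>' $ i) \<omega> = Z' \<omega> $ i"
    by (rule eventually_all_finite) (rule cond_meanD[OF assms])
  then show ?thesis by eventually_elim (simp add: cond_exp_vec_def vec_eq_iff)
qed

text \<open>\<open>F \<omega> u\<close> is the conditional cost of the input value \<open>u\<close>.
  The measurable pointwise minimizer \<open>V\<close> shows that a minimum exists. Whichever version
  the choice operator picks, it is attained by some \<open>U\<close> and so is at least the cost of
  \<open>V\<close>, and it is a lower bound and so is at most that cost.\<close>

lemma min_cond_cost_AE:
  assumes c: "\<And>U. U \<in> borel_measurable I \<Longrightarrow> AE \<omega> in M. real_cond_exp M I (c U) \<omega> = F \<omega> (U \<omega>)"
    and V: "V \<in> borel_measurable I" "\<And>\<omega> u. F \<omega> (V \<omega>) \<le> F \<omega> u"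
    and F: "(\<lambda>\<omega>. F \<omega> (V \<omega>)) \<in> borel_measurable I"
  shows "AE \<omega> in M. min_cond_cost M I c \<omega> = F \<omega> (V \<omega>)"
proof -
  have "is_min_cond_cost M I c (\<lambda>\<omega>. F \<omega> (V \<omega>))"
    unfolding is_min_cond_cost_def
  proof (intro conjI bexI ballI)
    show "AE \<omega> in M. F \<omega> (V \<omega>) \<le> real_cond_exp M I (c U) \<omega>" if "U \<in> borel_measurable I" for U
      using c[OF that] by eventually_elim (simp add: V(2))
    show "AE \<omega> in M. F \<omega> (V \<omega>) = real_cond_exp M I (c V) \<omega>"
      using c[OF V(1)] by eventually_elim simp
  qed (fact V(1) F)+
  then have "is_min_cond_cost M I c (min_cond_cost M I c)"
    unfolding min_cond_cost_def by (rule someI[of "is_min_cond_cost M I c"])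
  then obtain U where U: "U \<in> borel_measurable I"
      "AE \<omega> in M. min_cond_cost M I c \<omega> = real_cond_exp M I (c U) \<omega>"
    and le: "AE \<omega> in M. min_cond_cost M I c \<omega> \<le> real_cond_exp M I (c V) \<omega>"
    using V(1) unfolding is_min_cond_cost_def by blast
  from U(2) le c[OF U(1)] c[OF V(1)] show ?thesis
  proof eventually_elim
    case (elim \<omega>)
    then show ?case using V(2)[of \<omega> "U \<omega>"] by simp
  qed
qed

lemma (in prob_space) gaussian_vector_component:
  assumes "pos_definite S" "gaussian_vector M Z 0 S"
  shows "integrable M (\<lambda>\<omega>. Z \<omega> $ i)" "expectation (\<lambda>\<omega>. Z \<omega> $ i) = 0"
    "integrable M (\<lambda>\<omega>. (Z \<omega> $ i)\<^sup>2)"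
proof -
  let ?s = "sqrt (S $ i $ i)"
  have s: "0 < ?s" using pos_definite_diagonal_entry[OF assms(1)] by simp
  have D: "distributed M lborel (\<lambda>\<omega>. Z \<omega> $ i) (normal_density 0 ?s)"
    using assms(2)[unfolded gaussian_vector_def, THEN conjunct2, rule_format, of "axis i 1"]
    by (simp add: inner_axis' axis_eq_0_iff matrix_vector_mult_basis column_def)
  show "expectation (\<lambda>\<omega>. Z \<omega> $ i) = 0"
    using normal_distributed_expectation[OF s D] .
  show "integrable M (\<lambda>\<omega>. Z \<omega> $ i)"
    using distributed_integrable[OF D, of "\<lambda>x. x"] integrable_normal_moment_nz_1[OF s, of 0] by simp
  show "integrable M (\<lambda>\<omega>. (Z \<omega> $ i)\<^sup>2)"
    using distributed_integrable[OF D, of "\<lambda>x. x\<^sup>2"] integrable_normal_moment[OF s, of 0 2] by simp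
qed

text \<open>A nonzero row of \<open>T\<close> turns \<open>Z\<close> into a scalar variable with a
  density, which has no atom at 0.\<close>

lemma (in prob_space) gaussian_vector_AE_nonzero:
  assumes "gaussian_vector M Z c S" "T \<noteq> 0"
  shows "AE \<omega> in M. T *v Z \<omega> \<noteq> 0"
proof -
  obtain i where i: "row i T \<noteq> 0"
    using assms(2) by (auto simp: vec_eq_iff row_def)
  then have D: "distributed M lborel (\<lambda>\<omega>. row i T \<bullet> Z \<omega>)
      (normal_density (row i T \<bullet> c) (sqrt (row i T \<bullet> (S *v row i T))))" (is "distributed _ _ ?Y ?f")
    using assms(1) by (simp add: gaussian_vector_def)
  have "emeasure M (?Y -` {0} \<inter> space M) = (\<integral>\<^sup>+ x. ?f x * indicator {0} x \<partial>lborel)"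
    by (rule distributed_emeasure[OF D]) simp
  also have "\<dots> = 0"
    by (subst nn_integral_0_iff_AE) (use AE_lborel_singleton[of "0::real"] in \<open>auto elim!: eventually_mono\<close>)
  finally have "AE \<omega> in M. ?Y \<omega> \<noteq> 0"
    using distributed_measurable[OF D]
    by (subst AE_iff_measurable[where N = "?Y -` {0} \<inter> space M"]) auto
  then show ?thesis
  proof eventually_elim
    case (elim \<omega>)
    have "(T *v Z \<omega>) $ i = row i T \<bullet> Z \<omega>"
      by (simp add: matrix_vector_mult_def row_def inner_vec_def)
    then show ?case using elim by auto
  qed
qed

section \<open>The plant with lossy channels\<close>

text \<open>The inputs \<open>u\<close> are those actually applied to the plant, as opposed to the
  stacked inputs \<open>U\<close> over which the cost is minimized. Measurability in the TCP
  information covers both protocols, because the UDP information is coarser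
  (\<open>info_tcp_udp\<close>).\<close>

locale lossy_plant = prob_space M for M :: "'a measure" +
  fixes A :: "real^'n^'n" and B :: "real^'m^'n" and \<mu> :: "real^'m"
    and X :: "nat \<Rightarrow> 'a \<Rightarrow> real^'n" and u :: "nat \<Rightarrow> 'a \<Rightarrow> real^'m"
    and W :: "nat \<Rightarrow> 'a \<Rightarrow> real^'n" and L :: "nat \<Rightarrow> 'm::finite \<Rightarrow> 'a \<Rightarrow> bool"
    and \<Sigma>\<^sub>W :: "real^'n^'n"
  assumes noise: "pos_definite \<Sigma>\<^sub>W" "\<And>j. gaussian_vector M (W j) 0 \<Sigma>\<^sub>W"
    and mean: "\<And>i. 0 \<le> \<mu> $ i \<and> \<mu> $ i \<le> 1"
    and channel: "\<And>j i. L j i \<in> measurable M (count_space UNIV)"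
      "\<And>j i. distr M (count_space UNIV) (L j i) = measure_pmf (bernoulli_pmf (\<mu> $ i))"
    and initial: "X 0 \<in> borel_measurable M"
    and indep: "independent_sources M (X 0) W L"
    and inputs: "\<And>j. u j \<in> borel_measurable (info_tcp M X L j)"
    and plant: "\<And>j \<omega>. \<omega> \<in> space M \<Longrightarrow>
        X (Suc j) \<omega> = A *v X j \<omega> + B *v (Vmat L j \<omega> *v u j \<omega>) + W j \<omega>"
begin

section \<open>Sources of randomness and the information they generate\<close>

definition src :: "'m source \<Rightarrow> 'a set set" where
  "src s = (case s of
            Init \<Rightarrow> preimages M (X 0) borel
          | Noise k \<Rightarrow> preimages M (W k) borel
          | Channel k i \<Rightarrow> preimages M (L k i) (count_space UNIV))"

definition gen :: "'m source set \<Rightarrow> 'a measure" where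
  "gen S = sigma (space M) (\<Union>s\<in>S. src s)"

text \<open>The sources that can have influenced the state at time \<open>k\<close>: the plant
  equation uses noise and channel outcomes of time \<open>j\<close> only to produce
  \<open>X (Suc j)\<close>. Those of time \<open>k\<close> and later are still fresh, hence the
  strict bounds.\<close>

definition past :: "nat \<Rightarrow> 'm source set" where
  "past k = insert Init (Noise ` {..<k} \<union> (\<Union>j<k. range (Channel j)))"

lemma indep_src: "indep_sets src UNIV"
  using indep unfolding independent_sources_def src_def[abs_def] by simp

lemma Int_stable_preimages: "Int_stable (preimages M f N)"
proof (rule Int_stableI)
  fix a b assume "a \<in> preimages M f N" "b \<in> preimages M f N"
  then obtain S T where "S \<in> sets N" "T \<in> sets N" "a = f -` S \<inter> space M" "b = f -` T \<inter> space M"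
    by (auto simp: preimages_def)
  then have "S \<inter> T \<in> sets N" "a \<inter> b = f -` (S \<inter> T) \<inter> space M" by auto
  then show "a \<inter> b \<in> preimages M f N" unfolding preimages_def by blast
qed

lemma Int_stable_src: "Int_stable (src s)"
  by (cases s) (simp_all add: src_def Int_stable_preimages)

lemma src_events: "src s \<subseteq> events"
  using indep_src by (simp add: indep_sets_def)

lemma space_gen: "space (gen S) = space M"
  by (simp add: gen_def space_measure_of_conv)

lemma src_subset_gen: "s \<in> S \<Longrightarrow> src s \<subseteq> sets (gen S)"
  using src_events sets.space_closed[of M] by (force simp: gen_def sets_measure_of_conv)

lemma subalgebra_gen: "subalgebra M (gen S)"
  unfolding gen_def using src_events by (intro sigma_subalgebra) auto

lemma gen_mono: "S \<subseteq> T \<Longrightarrow> subalgebra (gen T) (gen S)"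
  unfolding gen_def[of S] using src_subset_gen[of _ T] by (intro sigma_subalgebra space_gen) blast

lemma initial_gen: "Init \<in> S \<Longrightarrow> X 0 \<in> borel_measurable (gen S)"
  using src_subset_gen[of Init S] by (intro measurable_preimages[OF space_gen]) (auto simp: src_def)

lemma noise_gen: "Noise j \<in> S \<Longrightarrow> W j \<in> borel_measurable (gen S)"
  using src_subset_gen[of "Noise j" S] by (intro measurable_preimages[OF space_gen]) (auto simp: src_def)

lemma channel_gen: "Channel j i \<in> S \<Longrightarrow> L j i \<in> measurable (gen S) (count_space UNIV)"
  using src_subset_gen[of "Channel j i" S] by (intro measurable_preimages[OF space_gen]) (auto simp: src_def)

lemma received_gen:
  assumes "Channel j i \<in> S"
  shows "(\<lambda>\<omega>. of_bool (L j i \<omega>) :: real) \<in> borel_measurable (gen S)"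
  by (rule measurable_compose[OF channel_gen[OF assms]]) simp

lemma Vmat_gen:
  assumes "\<And>i. Channel j i \<in> S"
  shows "Vmat L j \<in> borel_measurable (gen S)"
proof (intro borel_measurable_vecI)
  fix i i'
  show "(\<lambda>\<omega>. Vmat L j \<omega> $ i $ i') \<in> borel_measurable (gen S)"
    using received_gen[OF assms, of i] by (cases "i = i'") (simp_all add: Vmat_def diag_def)
qed

text \<open>Measurability of the states is kept as a premise because this lemma is used inside the
  induction that proves it.\<close>

lemma info_tcp_subalgebra:
  assumes "\<And>i. i \<le> j \<Longrightarrow> X i \<in> borel_measurable (gen (past j))"
  shows "subalgebra (gen (past j)) (info_tcp M X L j)"
  unfolding info_tcp_def
proof (intro sigma_subalgebra space_gen Un_least UN_least)
  show "preimages M (X i) borel \<subseteq> sets (gen (past j))" if "i \<in> {..j}" for i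
    using assms[of i] that by (intro preimages_subset_sets space_gen) auto
  show "preimages M (Vmat L i) borel \<subseteq> sets (gen (past j))" if "i \<in> {..<j}" for i
    using that by (intro preimages_subset_sets space_gen Vmat_gen) (auto simp: past_def)
qed

text \<open>The induction has to be strong: the input at time \<open>i\<close> may depend on all
  states up to \<open>i\<close>. The step to \<open>Suc i\<close> adds the noise and the channel
  outcomes of time \<open>i\<close>, which \<open>past (Suc i)\<close> contains.\<close>

lemma state_past: "X j \<in> borel_measurable (gen (past j))"
proof (induction j rule: less_induct)
  case (less j)
  have mono: "past i \<subseteq> past j" if "i \<le> j" for i j
    using that by (force simp: past_def)
  have up: "f \<in> borel_measurable (gen (past j))" if "f \<in> borel_measurable (gen (past i))" "i \<le> j"
    for f :: "'a \<Rightarrow> 'c::topological_space" and i j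
    using measurable_from_subalg[OF gen_mono[OF mono]] that by blast
  show ?case
  proof (cases j)
    case 0
    then show ?thesis by (simp add: initial_gen past_def)
  next
    case (Suc i)
    have X: "X l \<in> borel_measurable (gen (past i))" if "l \<le> i" for l
      using up[OF less.IH[of l]] that Suc by simp
    have ui: "u i \<in> borel_measurable (gen (past i))"
      by (rule measurable_from_subalg[OF info_tcp_subalgebra[OF X] inputs])
    have u: "u i \<in> borel_measurable (gen (past j))" by (rule up[OF ui]) (simp add: Suc)
    have "Vmat L i \<omega> *v u i \<omega> = (\<chi> c. of_bool (L i c \<omega>) * u i \<omega> $ c)" for \<omega>
      by (simp add: Vmat_def diag_mult_vec)
    moreover have "(\<lambda>\<omega>. \<chi> c. of_bool (L i c \<omega>) * u i \<omega> $ c) \<in> borel_measurable (gen (past j))"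
    proof (rule borel_measurable_vecI)
      fix c
      have [measurable]: "(\<lambda>\<omega>. of_bool (L i c \<omega>) :: real) \<in> borel_measurable (gen (past j))"
        by (rule received_gen) (auto simp: past_def Suc)
      have [measurable]: "(\<lambda>\<omega>. u i \<omega> $ c) \<in> borel_measurable (gen (past j))"
        by (rule borel_measurable_vec_nth[OF u])
      show "(\<lambda>\<omega>. (\<chi> c. of_bool (L i c \<omega>) * u i \<omega> $ c) $ c) \<in> borel_measurable (gen (past j))"
        by simp
    qed
    ultimately have Vu: "(\<lambda>\<omega>. Vmat L i \<omega> *v u i \<omega>) \<in> borel_measurable (gen (past j))" by simp
    have W: "W i \<in> borel_measurable (gen (past j))"
      by (rule noise_gen) (auto simp: past_def Suc)
    have Xi: "X i \<in> borel_measurable (gen (past j))" by (rule up[OF X[OF order_refl]]) (simp add: Suc)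
    have "(\<lambda>\<omega>. A *v X i \<omega> + B *v (Vmat L i \<omega> *v u i \<omega>) + W i \<omega>) \<in> borel_measurable (gen (past j))"
      by (intro borel_measurable_add borel_measurable_matrix_vector_mult Vu W Xi)
    then show ?thesis
      unfolding Suc by (subst measurable_cong[OF plant]) (simp_all add: space_gen)
  qed
qed

lemma info_tcp_past: "subalgebra (gen (past k)) (info_tcp M X L k)"
proof (rule info_tcp_subalgebra)
  fix i assume "i \<le> k"
  then have "past i \<subseteq> past k" by (force simp: past_def)
  then show "X i \<in> borel_measurable (gen (past k))"
    using measurable_from_subalg[OF gen_mono state_past] by blast
qed

lemma preimages_Pow: "preimages M f N \<subseteq> Pow (space M)"
  by (auto simp: preimages_def)

lemma info_tcp_udp: "subalgebra (info_tcp M X L k) (info_udp M X k)"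
proof -
  have "(\<Union>j\<le>k. preimages M (X j) borel) \<union> (\<Union>j<k. preimages M (Vmat L j) borel) \<subseteq> Pow (space M)"
    by (intro Un_least UN_least preimages_Pow)
  then have "(\<Union>j\<le>k. preimages M (X j) borel) \<subseteq> sets (info_tcp M X L k)"
    unfolding info_tcp_def by (simp add: sets_measure_of subset_eq)
  then show ?thesis
    unfolding info_udp_def by (intro sigma_subalgebra) (simp_all add: info_tcp_def space_measure_of_conv)
qed

lemma info_udp_past: "subalgebra (gen (past k)) (info_udp M X k)"
  by (rule subalgebra_trans[OF info_tcp_past info_tcp_udp])

lemma state_info_udp: "X k \<in> borel_measurable (info_udp M X k)"
proof (rule measurable_preimages)
  have "(\<Union>j\<le>k. preimages M (X j) borel) \<subseteq> Pow (space M)"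
    by (intro UN_least preimages_Pow)
  then show "preimages M (X k) borel \<subseteq> sets (info_udp M X k)"
    unfolding info_udp_def by (simp add: sets_measure_of) blast
qed (auto simp: info_udp_def space_measure_of_conv)

lemma state_info_tcp: "X k \<in> borel_measurable (info_tcp M X L k)"
  by (rule measurable_from_subalg[OF info_tcp_udp state_info_udp])

section \<open>Moments of fresh channel outcomes and noise\<close>

definition recv :: "nat \<Rightarrow> 'h::{finite,linorder} \<times> 'm \<Rightarrow> 'a \<Rightarrow> real" where
  "recv k p \<omega> = of_bool (L (k + blk (fst p)) (snd p) \<omega>)"

definition noises :: "nat \<Rightarrow> 'a \<Rightarrow> real^('h::{finite,linorder} \<times> 'n)" where
  "noises k \<omega> = stack (\<lambda>l. W (k + l) \<omega>)"

lemma noises_nth: "noises k \<omega> $ s = W (k + blk (fst s)) \<omega> $ snd s"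
  by (simp add: noises_def stack_def)

lemma Ups_mult: "Ups L k \<omega> *v y = (\<chi> p. recv k p \<omega> * y $ p)"
  by (simp add: Ups_eq diag_mult_vec recv_def)

lemma Ups_mean_mult: "Ups_mean \<mu> *v y = (\<chi> p. \<mu> $ snd p * y $ p)"
  by (simp add: Ups_mean_eq diag_mult_vec)

lemma recv_gen: "Channel (k + blk (fst p)) (snd p) \<in> S \<Longrightarrow> recv k p \<in> borel_measurable (gen S)"
  unfolding recv_def[abs_def] by (rule received_gen)

lemma noises_gen:
  "Noise (k + blk (fst s)) \<in> S \<Longrightarrow> (\<lambda>\<omega>. noises k \<omega> $ s) \<in> borel_measurable (gen S)"
  unfolding noises_nth by (intro borel_measurable_vec_nth noise_gen)

lemma gen_M: "f \<in> borel_measurable (gen S) \<Longrightarrow> f \<in> borel_measurable M"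
  by (rule measurable_from_subalg[OF subalgebra_gen])

lemma recv_M [measurable]: "recv k p \<in> borel_measurable M"
  by (rule gen_M[OF recv_gen[OF UNIV_I]])

lemma noises_M [measurable]: "(\<lambda>\<omega>. noises k \<omega> $ s) \<in> borel_measurable M"
  by (rule gen_M[OF noises_gen[OF UNIV_I]])

lemma fresh: "Channel (k + b) i \<in> - past k" "Noise (k + b) \<in> - past k"
  by (auto simp: past_def)

lemma sub_finite_measure: "subalgebra (gen S) I \<Longrightarrow> finite_measure_subalgebra M I"
  using subalgebra_trans[OF subalgebra_gen]
  by (auto simp: finite_measure_subalgebra_def finite_measure_subalgebra_axioms_def finite_measure_axioms)

text \<open>The form in which independence enters all cost computations: \<open>I\<close> is known
  from the sources in \<open>S\<close>, typically \<open>past k\<close>, and \<open>h\<close>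
  depends on other sources only.\<close>

lemma cond_mean_gen:
  assumes "subalgebra (gen S) I" "h \<in> borel_measurable (gen T)" "S \<inter> T = {}" "integrable M h"
  shows "cond_mean M I h (\<lambda>_. expectation h)"
  using cond_mean_indep[OF indep_src Int_stable_src assms(3), folded gen_def, OF assms(1,2,4)] .

lemma expectation_mult_gen:
  fixes f g :: "'a \<Rightarrow> real"
  assumes "f \<in> borel_measurable (gen S)" "g \<in> borel_measurable (gen T)" "S \<inter> T = {}"
    "integrable M f" "integrable M g"
  shows "integrable M (\<lambda>\<omega>. f \<omega> * g \<omega>)" "expectation (\<lambda>\<omega>. f \<omega> * g \<omega>) = expectation f * expectation g"
  using indep_sources_mult[OF indep_src Int_stable_src assms(3), folded gen_def, OF assms(1,2,4,5)]
  by auto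

lemma channel_expectation:
  "expectation (\<lambda>\<omega>. f (L j i \<omega>)) = f True * \<mu> $ i + f False * (1 - \<mu> $ i)" for f :: "bool \<Rightarrow> real"
proof -
  have "expectation (\<lambda>\<omega>. f (L j i \<omega>)) = integral\<^sup>L (distr M (count_space UNIV) (L j i)) f"
    by (rule integral_distr[symmetric]) (simp_all add: channel(1))
  then show ?thesis using mean[of i] by (simp add: channel(2))
qed

lemma recv_integrable: "integrable M (recv k p)"
  by (rule integrable_const_bound[where B = 1]) (auto simp: recv_def)

lemma recv_expectation: "expectation (recv k p) = \<mu> $ snd p"
  using channel_expectation[of of_bool] by (simp add: recv_def[abs_def])

text \<open>The Bernoulli variance is the origin of the factor \<mu>(1 - \<mu>) in the gap. Off the
  diagonal, time or channel differs by \<open>inj_blk\<close>, so two centred independent variables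
  are multiplied.\<close>

lemma recv_dev_expectation:
  fixes p q :: "'h::{finite,linorder} \<times> 'm"
  shows "expectation (\<lambda>\<omega>. (recv k p \<omega> - \<mu> $ snd p) * (recv k q \<omega> - \<mu> $ snd q))
    = (if p = q then \<mu> $ snd p * (1 - \<mu> $ snd p) else 0)"
proof (cases "p = q")
  case True
  have "expectation (\<lambda>\<omega>. (recv k p \<omega> - \<mu> $ snd p) * (recv k p \<omega> - \<mu> $ snd p)) = \<mu> $ snd p * (1 - \<mu> $ snd p)"
    unfolding recv_def
    by (subst channel_expectation[of "\<lambda>b. (of_bool b - \<mu> $ snd p) * (of_bool b - \<mu> $ snd p)"])
      (simp add: algebra_simps)
  then show ?thesis using True by simp
next
  case False
  let ?s = "\<lambda>p :: 'h \<times> 'm. {Channel (k + blk (fst p)) (snd p)}"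
  have "expectation (\<lambda>\<omega>. (recv k p \<omega> - \<mu> $ snd p) * (recv k q \<omega> - \<mu> $ snd q))
     = expectation (\<lambda>\<omega>. recv k p \<omega> - \<mu> $ snd p) * expectation (\<lambda>\<omega>. recv k q \<omega> - \<mu> $ snd q)"
  proof (rule expectation_mult_gen(2)[of _ "?s p" _ "?s q"])
    show "?s p \<inter> ?s q = {}"
      using False by (auto simp: prod_eq_iff dest: injD[OF inj_blk])
  qed (auto intro!: recv_gen borel_measurable_diff Bochner_Integration.integrable_diff recv_integrable)
  also have "expectation (\<lambda>\<omega>. recv k p \<omega> - \<mu> $ snd p) = 0"
    by (simp add: Bochner_Integration.integral_diff recv_integrable recv_expectation prob_space)
  finally show ?thesis using False by simp
qed

lemma recv_dev_integrable:
  fixes p q :: "'h::{finite,linorder} \<times> 'm"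
  shows "integrable M (\<lambda>\<omega>. (recv k p \<omega> - \<mu> $ snd p) * (recv k q \<omega> - \<mu> $ snd q))"
proof (rule integrable_const_bound[where B = 1])
  have "\<bar>recv k p \<omega> - \<mu> $ snd p\<bar> \<le> 1" for p :: "'h \<times> 'm" and \<omega>
    using mean[of "snd p"] by (auto simp: recv_def)
  then show "AE \<omega> in M. norm ((recv k p \<omega> - \<mu> $ snd p) * (recv k q \<omega> - \<mu> $ snd q)) \<le> 1"
    by (intro AE_I2) (simp only: real_norm_def abs_mult mult_le_one abs_ge_zero)
qed simp

lemma noises_integrable: "integrable M (\<lambda>\<omega>. noises k \<omega> $ s)"
  and noises_expectation: "expectation (\<lambda>\<omega>. noises k \<omega> $ s) = 0"
  using gaussian_vector_component[OF noise(1) noise(2)] by (simp_all add: noises_nth)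

text \<open>Noise components of the same time may be correlated through
  \<open>\<Sigma>\<^sub>W\<close>, so integrability is drawn from second moments and not from
  independence.\<close>

lemma noises_mult_integrable:
  fixes s t :: "'h::{finite,linorder} \<times> 'n"
  shows "integrable M (\<lambda>\<omega>. noises k \<omega> $ s * noises k \<omega> $ t)"
proof -
  have "integrable M (\<lambda>\<omega>. (noises k \<omega> $ s)\<^sup>2)" for s :: "'h \<times> 'n"
    unfolding noises_nth by (rule gaussian_vector_component(3)[OF noise])
  then show ?thesis by (intro integrable_mult_squares noises_M)
qed

lemma recv_dev_noises:
  "integrable M (\<lambda>\<omega>. (recv k p \<omega> - \<mu> $ snd p) * noises k \<omega> $ s)"
  "expectation (\<lambda>\<omega>. (recv k p \<omega> - \<mu> $ snd p) * noises k \<omega> $ s) = 0"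
proof -
  have *: "(\<lambda>\<omega>. recv k p \<omega> - \<mu> $ snd p) \<in> borel_measurable (gen {Channel (k + blk (fst p)) (snd p)})"
    "(\<lambda>\<omega>. noises k \<omega> $ s) \<in> borel_measurable (gen {Noise (k + blk (fst s))})"
    "{Channel (k + blk (fst p)) (snd p)} \<inter> {Noise (k + blk (fst s))} = {}"
    "integrable M (\<lambda>\<omega>. recv k p \<omega> - \<mu> $ snd p)"
    by (auto intro!: recv_gen noises_gen borel_measurable_diff Bochner_Integration.integrable_diff recv_integrable)
  show "integrable M (\<lambda>\<omega>. (recv k p \<omega> - \<mu> $ snd p) * noises k \<omega> $ s)"
    by (rule expectation_mult_gen(1)[OF * noises_integrable])
  show "expectation (\<lambda>\<omega>. (recv k p \<omega> - \<mu> $ snd p) * noises k \<omega> $ s) = 0"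
    using expectation_mult_gen(2)[OF * noises_integrable] by (simp add: noises_expectation)
qed

lemma noises_form_sum:
  "(\<lambda>\<omega>. (S *v noises k \<omega>) \<bullet> (T *v (S *v noises k \<omega>)))
    = (\<lambda>\<omega>. \<Sum>s\<in>UNIV. \<Sum>t\<in>UNIV. (noises k \<omega> $ s * noises k \<omega> $ t) * (transpose S ** T ** S) $ s $ t)"
  unfolding inner_congruence unfolding inner_matrix_vector_mult_sum ..

lemma cond_mean_noises_form:
  assumes "subalgebra (gen (past k)) I"
  shows "cond_mean M I (\<lambda>\<omega>. (S *v noises k \<omega>) \<bullet> (T *v (S *v noises k \<omega>)))
    (\<lambda>_. expectation (\<lambda>\<omega>. (S *v noises k \<omega>) \<bullet> (T *v (S *v noises k \<omega>))))"
proof (rule cond_mean_gen[OF assms])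
  show "(\<lambda>\<omega>. (S *v noises k \<omega>) \<bullet> (T *v (S *v noises k \<omega>))) \<in> borel_measurable (gen (- past k))"
    unfolding noises_form_sum
    by (intro borel_measurable_sum borel_measurable_times borel_measurable_const noises_gen fresh)
  show "integrable M (\<lambda>\<omega>. (S *v noises k \<omega>) \<bullet> (T *v (S *v noises k \<omega>)))"
    unfolding noises_form_sum
    by (intro Bochner_Integration.integrable_sum integrable_mult_left noises_mult_integrable)
qed simp

text \<open>The source set \<open>S\<close> is left general because the TCP error conditions on
  future channel outcomes as well; it must merely avoid the noise from time \<open>k\<close>
  on.\<close>

lemma cond_mean_linear_noises:
  assumes "subalgebra (gen S) I" "\<And>j. k \<le> j \<Longrightarrow> Noise j \<notin> S"
  shows "cond_mean M I (\<lambda>\<omega>. (T *v noises k \<omega>) $ i) (\<lambda>_. 0)"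
proof -
  interpret finite_measure_subalgebra M I by (rule sub_finite_measure) fact
  have "cond_mean M I (\<lambda>\<omega>. noises k \<omega> $ s) (\<lambda>_. 0)" for s
    using cond_mean_gen[OF assms(1) noises_gen[of k s, OF singletonI] _ noises_integrable] assms(2)
    by (simp add: noises_expectation)
  from cond_mean_sum[OF cond_mean_scale[OF this, of "\<lambda>_. T $ i $ s" for s]]
  show ?thesis by (simp add: matrix_vector_mult_def)
qed

section \<open>Closed forms of the prediction errors\<close>

lemma stacked_state_eq:
  "stacked_state A B X W L k U \<omega> = Phi A *v X k \<omega> + Gamma A B *v (Ups L k \<omega> *v U \<omega>) + Lambda A *v noises k \<omega>"
  by (simp add: stacked_state_def noises_def)

text \<open>Once \<open>Ups L k\<close> is known too, the input term is measurable and only the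
  fresh noise, of conditional mean 0, remains unpredictable.\<close>

lemma error_tcp_AE:
  fixes U :: "'a \<Rightarrow> real^('h::{finite,linorder} \<times> 'm)"
  assumes U: "U \<in> borel_measurable (info_tcp M X L k)"
  shows "AE \<omega> in M. error_tcp M A B X W L k U \<omega> = (Lambda A :: real^('h \<times> 'n)^('h \<times> 'n)) *v noises k \<omega>"
proof -
  let ?Y = "Ups L k :: 'a \<Rightarrow> real^('h \<times> 'm)^('h \<times> 'm)"
  let ?I = "info_join M (info_tcp M X L k) ?Y"
  \<comment> \<open>All channel outcomes, future ones included, but no noise from time
    \<open>k\<close> on: large enough to contain the conditioning sigma-algebra, small enough to
    stay independent of the fresh noise.\<close>
  let ?S = "past k \<union> (\<Union>j. range (Channel j))"
  let ?Z = "\<lambda>\<omega>. Phi A *v X k \<omega> + Gamma A B *v (?Y \<omega> *v U \<omega>) :: real^('h \<times> 'n)"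
  have Y: "?Y \<in> borel_measurable (gen ?S)"
  proof (intro borel_measurable_vecI)
    fix p q :: "'h \<times> 'm"
    have "(recv k p) \<in> borel_measurable (gen ?S)" by (rule recv_gen) auto
    then show "(\<lambda>\<omega>. ?Y \<omega> $ p $ q) \<in> borel_measurable (gen ?S)"
      by (cases "p = q") (simp_all add: Ups_eq diag_def recv_def[abs_def])
  qed
  have sp: "space (info_tcp M X L k) = space M" by (simp add: info_tcp_def space_measure_of_conv)
  have sub: "subalgebra (gen ?S) ?I"
    unfolding info_join_def
    using subalgebra_trans[OF gen_mono[of "past k" ?S] info_tcp_past] preimages_subset_sets[OF Y space_gen]
    by (intro sigma_subalgebra space_gen) (auto simp: subalgebra_def)
  then interpret finite_measure_subalgebra M ?I by (rule sub_finite_measure)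
  have "sets (info_tcp M X L k) \<union> preimages M ?Y borel \<subseteq> Pow (space M)"
    using sets.space_closed[of "info_tcp M X L k"] preimages_Pow[of ?Y borel] sp by auto
  then have sets: "sets ?I = sigma_sets (space M) (sets (info_tcp M X L k) \<union> preimages M ?Y borel)"
    "space ?I = space M"
    unfolding info_join_def by (rule sets_measure_of, simp add: space_measure_of_conv)
  have tcp: "subalgebra ?I (info_tcp M X L k)"
    using sets sp by (auto simp: subalgebra_def)
  have YI: "?Y \<in> borel_measurable ?I"
    using sets by (intro measurable_preimages) auto
  have X: "X k \<in> borel_measurable ?I" and UI: "U \<in> borel_measurable ?I"
    using measurable_from_subalg[OF tcp] state_info_tcp U by auto
  have Z: "?Z \<in> borel_measurable ?I"
  proof (intro borel_measurable_add borel_measurable_matrix_vector_mult X)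
    \<comment> \<open>\<open>?Y \<omega>\<close> is diagonal, so each coordinate of the product with
      the random matrix is a single product of two measurable entries.\<close>
    have "(\<lambda>\<omega>. ?Y \<omega> $ p $ p * U \<omega> $ p) \<in> borel_measurable ?I" for p
      by (intro borel_measurable_times borel_measurable_vec_nth YI UI)
    then show "(\<lambda>\<omega>. ?Y \<omega> *v U \<omega>) \<in> borel_measurable ?I"
      by (intro borel_measurable_vecI) (simp add: Ups_eq diag_mult_vec, simp add: diag_def)
  qed
  have "AE \<omega> in M. cond_exp_vec M ?I (stacked_state A B X W L k U) \<omega> = ?Z \<omega>"
  proof (rule cond_exp_vec_AE)
    fix i :: "'h \<times> 'n"
    have "Noise j \<notin> ?S" if "k \<le> j" for j using that by (auto simp: past_def)
    from cond_mean_add[OF cond_mean_measurable[OF borel_measurable_vec_nth[OF Z]] cond_mean_linear_noises[OF sub this]]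
    show "cond_mean M ?I (\<lambda>\<omega>. stacked_state A B X W L k U \<omega> $ i) (\<lambda>\<omega>. ?Z \<omega> $ i)"
      by (simp add: stacked_state_eq)
  qed
  then show ?thesis
    by eventually_elim (simp add: error_tcp_def stacked_state_eq)
qed

lemma cond_mean_recv:
  assumes "subalgebra (gen (past k)) I"
  shows "cond_mean M I (recv k p) (\<lambda>_. \<mu> $ snd p)"
  using cond_mean_gen[OF assms recv_gen[OF fresh(1)[of k "blk (fst p)" "snd p"]] _ recv_integrable] by (simp add: recv_expectation)

text \<open>The input is known but the outcomes of time \<open>k\<close> and later are not, so
  conditioning replaces each of them by its mean; the deviations from the mean remain in the
  error.\<close>

lemma error_udp_AE:
  fixes U :: "'a \<Rightarrow> real^('h::{finite,linorder} \<times> 'm)"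
  assumes U: "U \<in> borel_measurable (info_udp M X k)"
  shows "AE \<omega> in M. error_udp M A B X W L k U \<omega>
    = Gamma A B *v (\<chi> p. (recv k p \<omega> - \<mu> $ snd p) * U \<omega> $ p) + (Lambda A :: real^('h \<times> 'n)^('h \<times> 'n)) *v noises k \<omega>"
proof -
  let ?I = "info_udp M X k"
  let ?G = "Gamma A B :: real^('h \<times> 'm)^('h \<times> 'n)"
  interpret finite_measure_subalgebra M ?I by (rule sub_finite_measure[OF info_udp_past])
  have "AE \<omega> in M. cond_exp_vec M ?I (stacked_state A B X W L k U) \<omega>
      = Phi A *v X k \<omega> + ?G *v (Ups_mean \<mu> *v U \<omega>)"
  proof (rule cond_exp_vec_AE)
    fix i :: "'h \<times> 'n"
    have "(\<lambda>\<omega>. (Phi A *v X k \<omega>) $ i) \<in> borel_measurable ?I"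
      by (intro borel_measurable_vec_nth borel_measurable_matrix_vector_mult state_info_udp)
    then have 1: "cond_mean M ?I (\<lambda>\<omega>. (Phi A *v X k \<omega>) $ i) (\<lambda>\<omega>. (Phi A *v X k \<omega>) $ i)"
      by (rule cond_mean_measurable)
    have "(\<lambda>\<omega>. ?G $ i $ p * U \<omega> $ p) \<in> borel_measurable ?I" for p
      by (intro borel_measurable_times borel_measurable_const borel_measurable_vec_nth U)
    then have "cond_mean M ?I (\<lambda>\<omega>. \<Sum>p\<in>UNIV. (?G $ i $ p * U \<omega> $ p) * recv k p \<omega>)
        (\<lambda>\<omega>. \<Sum>p\<in>UNIV. (?G $ i $ p * U \<omega> $ p) * \<mu> $ snd p)"
      by (intro cond_mean_sum cond_mean_scale cond_mean_recv info_udp_past)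
    then have 2: "cond_mean M ?I (\<lambda>\<omega>. (?G *v (Ups L k \<omega> *v U \<omega>)) $ i) (\<lambda>\<omega>. (?G *v (Ups_mean \<mu> *v U \<omega>)) $ i)"
      by (simp add: Ups_mult Ups_mean_mult matrix_vector_mult_def[of ?G] ac_simps)
    have 3: "cond_mean M ?I (\<lambda>\<omega>. (Lambda A *v noises k \<omega>) $ i) (\<lambda>_. 0)"
      by (rule cond_mean_linear_noises[OF info_udp_past]) (auto simp: past_def)
    from cond_mean_add[OF cond_mean_add[OF 1 2] 3]
    show "cond_mean M ?I (\<lambda>\<omega>. stacked_state A B X W L k U \<omega> $ i)
        (\<lambda>\<omega>. (Phi A *v X k \<omega> + ?G *v (Ups_mean \<mu> *v U \<omega>)) $ i)"
      by (simp add: stacked_state_eq)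
  qed
  then show ?thesis
  proof eventually_elim
    case (elim \<omega>)
    have "(\<chi> p. (recv k p \<omega> - \<mu> $ snd p) * U \<omega> $ p) = Ups L k \<omega> *v U \<omega> - Ups_mean \<mu> *v U \<omega>"
      by (simp add: Ups_mult Ups_mean_mult vec_eq_iff algebra_simps)
    then show ?case
      by (simp add: error_udp_def elim stacked_state_eq matrix_vector_mult_diff_distrib)
  qed
qed

section \<open>Conditional costs of both protocols\<close>

definition noise_cost :: "real^('h::{finite,linorder} \<times> 'n)^('h \<times> 'n) \<Rightarrow> nat \<Rightarrow> real" where
  "noise_cost \<Omega> k = expectation (\<lambda>\<omega>. (Lambda A *v noises k \<omega>) \<bullet> (\<Omega> *v (Lambda A *v noises k \<omega>)))"

text \<open>With \<open>\<Psi>\<close> diagonal each outcome occurs only squared, and a 0/1 variable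
  equals its square. The cost is thus linear in the outcomes, and its conditional mean involves only
  the means \<open>\<mu>\<close>.\<close>

lemma channel_cost:
  fixes v :: "real^('h::{finite,linorder} \<times> 'm)"
  assumes "is_diagonal \<Psi>"
  shows "v \<bullet> ((transpose (Ups L k \<omega>) ** \<Psi> ** Ups L k \<omega>) *v v)
    = (\<Sum>p\<in>UNIV. (\<Psi> $ p $ p * (v $ p)\<^sup>2) * recv k p \<omega>)"
proof -
  let ?y = "Ups L k \<omega> *v v"
  have "v \<bullet> ((transpose (Ups L k \<omega>) ** \<Psi> ** Ups L k \<omega>) *v v) = ?y \<bullet> (\<Psi> *v ?y)"
    by (simp only: matrix_vector_mul_assoc[symmetric] inner_matrix_vector_mult[of v "transpose _"] transpose_transpose)
  also have "\<dots> = ?y \<bullet> (diag (\<chi> p. \<Psi> $ p $ p) *v ?y)"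
    using is_diagonal_eq_diag[OF assms] by simp
  also have "\<dots> = (\<Sum>p\<in>UNIV. (\<Psi> $ p $ p * (v $ p)\<^sup>2) * recv k p \<omega>)"
    unfolding diag_mult_vec Ups_mult inner_vec_def
    by (intro sum.cong refl) (simp add: recv_def power2_eq_square)
  finally show ?thesis .
qed

lemma state_M: "X k \<in> borel_measurable M"
  by (rule gen_M[OF state_past])

lemma predicted_state_eq:
  "predicted_state A B \<mu> X k U \<omega> = Phi A *v X k \<omega> + (Gamma A B ** Ups_mean \<mu>) *v U \<omega>"
  by (simp add: predicted_state_def matrix_vector_mul_assoc)

text \<open>Everything but the error term is common to the protocols. That term enters through an
  almost sure representative \<open>e\<close>, since the errors, defined by conditional
  expectations, have their closed forms only almost surely.\<close>

lemma running_cost_cond_exp: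
  fixes U :: "'a \<Rightarrow> real^('h::{finite,linorder} \<times> 'm)"
    and \<Omega> :: "real^('h \<times> 'n)^('h \<times> 'n)"
  assumes sub: "subalgebra (gen (past k)) I" and X: "X k \<in> borel_measurable I"
    and U: "U \<in> borel_measurable I" and \<Psi>: "is_diagonal \<Psi>"
    and err: "err U \<in> borel_measurable M" "AE \<omega> in M. err U \<omega> \<bullet> (\<Omega> *v err U \<omega>) = e \<omega>"
    and e: "cond_mean M I e e'"
  shows "AE \<omega> in M. real_cond_exp M I (running_cost A B \<mu> Q \<Omega> \<Psi> X L k err U) \<omega>
    = X k \<omega> \<bullet> (Q *v X k \<omega>) + e' \<omega>
      + quad_cost \<Omega> (Phi A) (Gamma A B ** Ups_mean \<mu>) (\<chi> p. \<Psi> $ p $ p * \<mu> $ snd p) (X k \<omega>) (U \<omega>)"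
proof -
  interpret finite_measure_subalgebra M I by (rule sub_finite_measure[OF sub])
  define base where "base \<omega> = X k \<omega> \<bullet> (Q *v X k \<omega>)
      + predicted_state A B \<mu> X k U \<omega> \<bullet> (\<Omega> *v predicted_state A B \<mu> X k U \<omega>)" for \<omega>
  have base: "base \<in> borel_measurable I"
    unfolding base_def[abs_def] predicted_state_eq
    by (intro borel_measurable_add borel_measurable_inner borel_measurable_matrix_vector_mult X U)
  have w: "(\<lambda>\<omega>. \<Psi> $ p $ p * (U \<omega> $ p)\<^sup>2) \<in> borel_measurable I" for p
    by (intro borel_measurable_times borel_measurable_power borel_measurable_const borel_measurable_vec_nth U)
  let ?s = "\<lambda>\<omega>. \<Sum>p\<in>UNIV. (\<Psi> $ p $ p * (U \<omega> $ p)\<^sup>2) * recv k p \<omega>"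
  let ?s' = "\<lambda>\<omega>. \<Sum>p\<in>UNIV. (\<Psi> $ p $ p * (U \<omega> $ p)\<^sup>2) * \<mu> $ snd p"
  have s: "cond_mean M I ?s ?s'"
    by (intro cond_mean_sum cond_mean_scale cond_mean_recv sub w)
  have cost: "running_cost A B \<mu> Q \<Omega> \<Psi> X L k err U = (\<lambda>\<omega>. base \<omega> + err U \<omega> \<bullet> (\<Omega> *v err U \<omega>) + ?s \<omega>)"
    by (intro ext) (simp only: running_cost_def base_def channel_cost[OF \<Psi>])
  have "?s \<in> borel_measurable M" "e \<in> borel_measurable M"
    using s e by (simp_all add: cond_mean_def)
  then have "AE \<omega> in M. real_cond_exp M I (\<lambda>\<omega>. base \<omega> + err U \<omega> \<bullet> (\<Omega> *v err U \<omega>) + ?s \<omega>) \<omega>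
      = real_cond_exp M I (\<lambda>\<omega>. base \<omega> + e \<omega> + ?s \<omega>) \<omega>"
    using err(2)
    by (intro real_cond_exp_cong borel_measurable_add borel_measurable_inner borel_measurable_matrix_vector_mult
        err(1) borel_measurable_sub[OF base]) (auto elim: eventually_mono)
  moreover have "AE \<omega> in M. real_cond_exp M I (\<lambda>\<omega>. base \<omega> + e \<omega> + ?s \<omega>) \<omega> = base \<omega> + e' \<omega> + ?s' \<omega>"
    by (rule cond_meanD) (intro cond_mean_add cond_mean_measurable base e s)
  ultimately have "AE \<omega> in M. real_cond_exp M I (running_cost A B \<mu> Q \<Omega> \<Psi> X L k err U) \<omega> = base \<omega> + e' \<omega> + ?s' \<omega>"
    unfolding cost by eventually_elim (rule trans)
  then show ?thesis
    by eventually_elim (simp add: base_def predicted_state_eq quad_cost_def ac_simps)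
qed

lemma stacked_state_M:
  fixes U :: "'a \<Rightarrow> real^('h::{finite,linorder} \<times> 'm)"
  assumes U: "U \<in> borel_measurable M"
  shows "stacked_state A B X W L k U \<in> borel_measurable M"
proof -
  have "(\<lambda>\<omega>. Ups L k \<omega> *v U \<omega>) \<in> borel_measurable M"
    unfolding Ups_mult
    by (intro borel_measurable_vecI) (simp add: borel_measurable_times borel_measurable_vec_nth[OF U] recv_M)
  moreover have "noises k \<in> borel_measurable M"
    by (intro borel_measurable_vecI noises_M)
  ultimately show ?thesis
    unfolding stacked_state_eq[abs_def]
    by (intro borel_measurable_add borel_measurable_matrix_vector_mult state_M)
qed

lemma cond_exp_vec_M: "cond_exp_vec M I Z \<in> borel_measurable M"
  by (intro borel_measurable_vecI) (simp add: cond_exp_vec_def)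

lemma tcp_cost_cond_exp:
  fixes U :: "'a \<Rightarrow> real^('h::{finite,linorder} \<times> 'm)" and \<Omega> :: "real^('h \<times> 'n)^('h \<times> 'n)"
  assumes U: "U \<in> borel_measurable (info_tcp M X L k)" and \<Psi>: "is_diagonal \<Psi>"
  shows "AE \<omega> in M. real_cond_exp M (info_tcp M X L k)
      (running_cost A B \<mu> Q \<Omega> \<Psi> X L k (error_tcp M A B X W L k) U) \<omega>
    = X k \<omega> \<bullet> (Q *v X k \<omega>) + noise_cost \<Omega> k
      + quad_cost \<Omega> (Phi A) (Gamma A B ** Ups_mean \<mu>) (\<chi> p. \<Psi> $ p $ p * \<mu> $ snd p) (X k \<omega>) (U \<omega>)"
proof (rule running_cost_cond_exp[OF info_tcp_past state_info_tcp U \<Psi>])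
  have "U \<in> borel_measurable M"
    by (rule gen_M[OF measurable_from_subalg[OF info_tcp_past U]])
  then show "error_tcp M A B X W L k U \<in> borel_measurable M"
    unfolding error_tcp_def[abs_def] by (intro borel_measurable_diff stacked_state_M cond_exp_vec_M)
  show "AE \<omega> in M. error_tcp M A B X W L k U \<omega> \<bullet> (\<Omega> *v error_tcp M A B X W L k U \<omega>)
      = (Lambda A *v noises k \<omega>) \<bullet> (\<Omega> *v (Lambda A *v noises k \<omega>))"
    using error_tcp_AE[OF U] by eventually_elim simp
qed (unfold noise_cost_def, rule cond_mean_noises_form[OF info_tcp_past])

text \<open>In the expanded form every summand is an \<open>I\<close>-measurable coefficient built
  from \<open>U\<close> times a product of fresh variables. Only the equal-index channel terms and
  the pure noise term have nonzero mean.\<close>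

lemma udp_error_cond_mean:
  fixes U :: "'a \<Rightarrow> real^('h::{finite,linorder} \<times> 'm)" and \<Omega> :: "real^('h \<times> 'n)^('h \<times> 'n)"
  assumes sub: "subalgebra (gen (past k)) I" and U: "U \<in> borel_measurable I" and \<Omega>: "transpose \<Omega> = \<Omega>"
  defines "y \<equiv> \<lambda>\<omega>. Gamma A B *v (\<chi> p. (recv k p \<omega> - \<mu> $ snd p) * U \<omega> $ p)"
    and "\<kappa> \<equiv> \<lambda>p. (transpose (Gamma A B) ** \<Omega> ** Gamma A B) $ p $ p"
  shows "cond_mean M I (\<lambda>\<omega>. (y \<omega> + Lambda A *v noises k \<omega>) \<bullet> (\<Omega> *v (y \<omega> + Lambda A *v noises k \<omega>)))
    (\<lambda>\<omega>. noise_cost \<Omega> k + (\<Sum>p\<in>UNIV. \<kappa> p * (\<mu> $ snd p * (1 - \<mu> $ snd p)) * (U \<omega> $ p)\<^sup>2))"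
proof -
  let ?z = "\<lambda>\<omega>. \<chi> p. (recv k p \<omega> - \<mu> $ snd p) * U \<omega> $ p"
  let ?G = "Gamma A B :: real^('h \<times> 'm)^('h \<times> 'n)" and ?L = "Lambda A :: real^('h \<times> 'n)^('h \<times> 'n)"
  let ?K = "transpose ?G ** \<Omega> ** ?G" and ?T = "transpose ?L ** \<Omega> ** ?G"
  interpret finite_measure_subalgebra M I by (rule sub_finite_measure[OF sub])
  have U': "(\<lambda>\<omega>. U \<omega> $ p) \<in> borel_measurable I" for p by (rule borel_measurable_vec_nth[OF U])
  \<comment> \<open>The coefficients are grouped on the left of each summand so that
    \<open>cond_mean_scale\<close> applies; the factor 2 uses the symmetry of
    \<open>\<Omega>\<close>.\<close>
  have form: "(y \<omega> + ?L *v noises k \<omega>) \<bullet> (\<Omega> *v (y \<omega> + ?L *v noises k \<omega>))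
     = (\<Sum>p\<in>UNIV. \<Sum>q\<in>UNIV. (U \<omega> $ p * U \<omega> $ q * ?K $ p $ q)
          * ((recv k p \<omega> - \<mu> $ snd p) * (recv k q \<omega> - \<mu> $ snd q)))
     + 2 * (\<Sum>s\<in>UNIV. \<Sum>p\<in>UNIV. (U \<omega> $ p * ?T $ s $ p) * ((recv k p \<omega> - \<mu> $ snd p) * noises k \<omega> $ s))
     + (?L *v noises k \<omega>) \<bullet> (\<Omega> *v (?L *v noises k \<omega>))" for \<omega>
  proof -
    have "(?G *v ?z \<omega>) \<bullet> (\<Omega> *v (?G *v ?z \<omega>)) = (\<Sum>p\<in>UNIV. \<Sum>q\<in>UNIV. (U \<omega> $ p * U \<omega> $ q * ?K $ p $ q)
          * ((recv k p \<omega> - \<mu> $ snd p) * (recv k q \<omega> - \<mu> $ snd q)))"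
      unfolding inner_congruence unfolding inner_matrix_vector_mult_sum by (intro sum.cong refl) (simp add: ac_simps)
    moreover have "(?L *v noises k \<omega>) \<bullet> (\<Omega> *v (?G *v ?z \<omega>))
        = (\<Sum>s\<in>UNIV. \<Sum>p\<in>UNIV. (U \<omega> $ p * ?T $ s $ p) * ((recv k p \<omega> - \<mu> $ snd p) * noises k \<omega> $ s))"
      unfolding inner_congruence unfolding inner_matrix_vector_mult_sum by (intro sum.cong refl) (simp add: ac_simps)
    ultimately show ?thesis
      unfolding y_def quadratic_form_add[OF \<Omega>] by simp
  qed
  have meas: "(\<lambda>\<omega>. recv k p \<omega> - \<mu> $ snd p) \<in> borel_measurable (gen (- past k))" for p :: "'h \<times> 'm"
    by (intro borel_measurable_diff recv_gen fresh borel_measurable_const)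
  have "cond_mean M I (\<lambda>\<omega>. (recv k p \<omega> - \<mu> $ snd p) * (recv k q \<omega> - \<mu> $ snd q))
      (\<lambda>_. if p = q then \<mu> $ snd p * (1 - \<mu> $ snd p) else 0)" for p q :: "'h \<times> 'm"
    unfolding recv_dev_expectation[of k p q, symmetric]
    by (rule cond_mean_gen[OF sub, where T = "- past k"]) (intro borel_measurable_times meas recv_dev_integrable Compl_disjoint)+
  then have 1: "cond_mean M I
     (\<lambda>\<omega>. \<Sum>p\<in>UNIV. \<Sum>q\<in>UNIV. (U \<omega> $ p * U \<omega> $ q * ?K $ p $ q)
          * ((recv k p \<omega> - \<mu> $ snd p) * (recv k q \<omega> - \<mu> $ snd q)))
     (\<lambda>\<omega>. \<Sum>p\<in>UNIV. \<Sum>q\<in>UNIV. (U \<omega> $ p * U \<omega> $ q * ?K $ p $ q)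
          * (if p = q then \<mu> $ snd p * (1 - \<mu> $ snd p) else 0))"
    by (intro cond_mean_sum cond_mean_scale borel_measurable_times U' borel_measurable_const)
  have "cond_mean M I (\<lambda>\<omega>. (recv k p \<omega> - \<mu> $ snd p) * noises k \<omega> $ s) (\<lambda>_. 0)"
    for p :: "'h \<times> 'm" and s :: "'h \<times> 'n"
    unfolding recv_dev_noises(2)[of k p s, symmetric]
    by (rule cond_mean_gen[OF sub, where T = "- past k"])
      (intro borel_measurable_times meas noises_gen fresh recv_dev_noises(1) Compl_disjoint)+
  then have 2: "cond_mean M I
     (\<lambda>\<omega>. 2 * (\<Sum>s\<in>UNIV. \<Sum>p\<in>UNIV. (U \<omega> $ p * ?T $ s $ p) * ((recv k p \<omega> - \<mu> $ snd p) * noises k \<omega> $ s)))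
     (\<lambda>\<omega>. 2 * (\<Sum>s\<in>UNIV. \<Sum>p\<in>UNIV. (U \<omega> $ p * ?T $ s $ p) * 0))"
    by (intro cond_mean_sum cond_mean_scale borel_measurable_times U' borel_measurable_const)
  from cond_mean_add[OF cond_mean_add[OF 1 2] cond_mean_noises_form[OF sub]]
  show ?thesis
    unfolding form
    by (simp add: noise_cost_def \<kappa>_def if_distrib[where f = "\<lambda>x. _ * x"] power2_eq_square ac_simps cong: if_cong)
qed

text \<open>The conditional covariance term is a diagonal quadratic form in the input and is
  absorbed into the weight of \<open>quad_cost\<close>; all that changes against TCP is this
  weight.\<close>

lemma udp_cost_cond_exp:
  fixes U :: "'a \<Rightarrow> real^('h::{finite,linorder} \<times> 'm)" and \<Omega> :: "real^('h \<times> 'n)^('h \<times> 'n)"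
  assumes U: "U \<in> borel_measurable (info_udp M X k)" and \<Psi>: "is_diagonal \<Psi>" and \<Omega>: "transpose \<Omega> = \<Omega>"
  shows "AE \<omega> in M. real_cond_exp M (info_udp M X k)
      (running_cost A B \<mu> Q \<Omega> \<Psi> X L k (error_udp M A B X W L k) U) \<omega>
    = X k \<omega> \<bullet> (Q *v X k \<omega>) + noise_cost \<Omega> k
      + quad_cost \<Omega> (Phi A) (Gamma A B ** Ups_mean \<mu>) (\<chi> p. \<Psi> $ p $ p * \<mu> $ snd p
          + (transpose (Gamma A B) ** \<Omega> ** Gamma A B) $ p $ p * (\<mu> $ snd p * (1 - \<mu> $ snd p))) (X k \<omega>) (U \<omega>)"
proof -
  have "U \<in> borel_measurable M"
    by (rule gen_M[OF measurable_from_subalg[OF info_udp_past U]])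
  then have "error_udp M A B X W L k U \<in> borel_measurable M"
    unfolding error_udp_def[abs_def] by (intro borel_measurable_diff stacked_state_M cond_exp_vec_M)
  moreover have "AE \<omega> in M. error_udp M A B X W L k U \<omega> \<bullet> (\<Omega> *v error_udp M A B X W L k U \<omega>)
      = (Gamma A B *v (\<chi> p. (recv k p \<omega> - \<mu> $ snd p) * U \<omega> $ p) + Lambda A *v noises k \<omega>)
        \<bullet> (\<Omega> *v (Gamma A B *v (\<chi> p. (recv k p \<omega> - \<mu> $ snd p) * U \<omega> $ p) + Lambda A *v noises k \<omega>))"
    using error_udp_AE[OF U] by eventually_elim simp
  ultimately have "AE \<omega> in M. real_cond_exp M (info_udp M X k)
      (running_cost A B \<mu> Q \<Omega> \<Psi> X L k (error_udp M A B X W L k) U) \<omega>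
    = X k \<omega> \<bullet> (Q *v X k \<omega>) + (noise_cost \<Omega> k
        + (\<Sum>p\<in>UNIV. (transpose (Gamma A B) ** \<Omega> ** Gamma A B) $ p $ p * (\<mu> $ snd p * (1 - \<mu> $ snd p)) * (U \<omega> $ p)\<^sup>2))
      + quad_cost \<Omega> (Phi A) (Gamma A B ** Ups_mean \<mu>) (\<chi> p. \<Psi> $ p $ p * \<mu> $ snd p) (X k \<omega>) (U \<omega>)"
    by (rule running_cost_cond_exp[OF info_udp_past state_info_udp U \<Psi> _ _ udp_error_cond_mean[OF info_udp_past U \<Omega>]])
  then show ?thesis
    by eventually_elim (simp add: quad_cost_def distrib_right sum.distrib)
qed

text \<open>The feedback \<open>K *v X k \<omega>\<close> minimizes for every
  \<open>\<omega>\<close> and is measurable in any information that contains \<open>X k\<close>, so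
  one lemma serves both protocols.\<close>

lemma Jstar_AE:
  fixes K :: "real^'n^('h::{finite,linorder} \<times> 'm)"
  assumes X: "X k \<in> borel_measurable I"
    and c: "\<And>U. U \<in> borel_measurable I \<Longrightarrow> AE \<omega> in M. real_cond_exp M I (c U) \<omega>
      = X k \<omega> \<bullet> (Q *v X k \<omega>) + w + quad_cost \<Omega> P G d (X k \<omega>) (U \<omega>)"
    and K: "\<And>x u. quad_cost \<Omega> P G d x (K *v x) \<le> quad_cost \<Omega> P G d x u"
  shows "AE \<omega> in M. min_cond_cost M I c \<omega>
    = X k \<omega> \<bullet> (Q *v X k \<omega>) + w + quad_cost \<Omega> P G d (X k \<omega>) (K *v X k \<omega>)"
proof (rule min_cond_cost_AE[OF c])
  show "(\<lambda>\<omega>. X k \<omega> \<bullet> (Q *v X k \<omega>) + w + quad_cost \<Omega> P G d (X k \<omega>) (K *v X k \<omega>)) \<in> borel_measurable I"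
    unfolding quad_cost_def
    by (intro borel_measurable_add borel_measurable_inner borel_measurable_sum borel_measurable_times
        borel_measurable_power borel_measurable_const borel_measurable_vec_nth
        borel_measurable_matrix_vector_mult X)
qed (simp_all add: K borel_measurable_matrix_vector_mult X)

end

text \<open>The condition \<open>nondegenerate\<close> excludes the case in which the linear term of
  the cost vanishes for every state. In that case both minimizers are 0, no input is exposed to
  packet loss, and the two optimal costs agree almost surely.\<close>

theorem theorem2:
  fixes M :: "'a measure"
    and A :: "real^'n^'n" and B :: "real^'m^'n"
    and \<mu> :: "real^'m"
    and X :: "nat \<Rightarrow> 'a \<Rightarrow> real^'n"
    and u :: "nat \<Rightarrow> 'a \<Rightarrow> real^'m"
    and W :: "nat \<Rightarrow> 'a \<Rightarrow> real^'n"
    and L :: "nat \<Rightarrow> 'm::finite \<Rightarrow> 'a \<Rightarrow> bool"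
    and \<Sigma>\<^sub>W \<Sigma>\<^sub>X Q :: "real^'n^'n" and m\<^sub>X :: "real^'n"
    and \<Omega> :: "real^('h::{finite,linorder} \<times> 'n)^('h \<times> 'n)"
    and \<Psi> :: "real^('h \<times> 'm)^('h \<times> 'm)"
    and k :: nat
  assumes prob: "prob_space M"
    and noise: "pos_definite \<Sigma>\<^sub>W" "\<And>j. gaussian_vector M (W j) 0 \<Sigma>\<^sub>W"
    and channels: "\<And>i. 0 \<le> \<mu> $ i \<and> \<mu> $ i \<le> 1"
      "\<And>j i. L j i \<in> measurable M (count_space UNIV)"
      "\<And>j i. distr M (count_space UNIV) (L j i) = measure_pmf (bernoulli_pmf (\<mu> $ i))"
    and initial: "X 0 \<in> borel_measurable M"
    and indep: "independent_sources M (X 0) W L"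
    and inputs: "\<And>j. u j \<in> borel_measurable (info_tcp M X L j)"
    and plant: "\<And>j \<omega>. \<omega> \<in> space M \<Longrightarrow>
        X (Suc j) \<omega> = A *v X j \<omega> + B *v (Vmat L j \<omega> *v u j \<omega>) + W j \<omega>"
    and state: "pos_definite \<Sigma>\<^sub>X" "gaussian_vector M (X k) m\<^sub>X \<Sigma>\<^sub>X"
    and weights: "is_diagonal Q" "pos_definite Q"
      "is_diagonal \<Omega>" "pos_definite \<Omega>"
      "is_diagonal \<Psi>" "pos_definite \<Psi>"
    and nondegenerate: "transpose (Gamma A B) ** \<Omega> ** Phi A \<noteq> 0"
    and loss: "0 \<prec>\<^sub>L diag \<mu>" "diag \<mu> \<prec>\<^sub>L mat 1"
  shows "AE \<omega> in M.
    Jstar_udp M A B \<mu> Q \<Omega> \<Psi> X W L k \<omega> - Jstar_tcp M A B \<mu> Q \<Omega> \<Psi> X W L k \<omega> > 0"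
proof -
  interpret prob_space M by (rule prob)
  interpret lossy_plant M A B \<mu> X u W L \<Sigma>\<^sub>W
    using noise channels initial indep inputs plant by unfold_locales
  have \<mu>: "0 < \<mu> $ i" "\<mu> $ i < 1" for i
    using pos_definite_diagonal_entry[OF loss(1)[unfolded loewner_less_def], of i]
      pos_definite_diagonal_entry[OF loss(2)[unfolded loewner_less_def], of i]
    by (simp_all add: diag_def mat_def)
  let ?G = "Gamma A B :: real^('h \<times> 'm)^('h \<times> 'n)"
  let ?P = "Phi A :: real^'n^('h \<times> 'n)"
  define \<nu> :: "real^('h \<times> 'm)" where "\<nu> = (\<chi> p. \<mu> $ snd p)"
  define d where "d = (\<chi> p. \<Psi> $ p $ p * \<mu> $ snd p)"
  \<comment> \<open>In \<open>d\<close> an input is charged when it is delivered, hence the mean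
    \<open>\<mu>\<close>; \<open>d'\<close> adds the Bernoulli variance scaled by the effect of that
    input on the trajectory cost.\<close>
  define d' where "d' = (\<chi> p. \<Psi> $ p $ p * \<mu> $ snd p
      + (transpose ?G ** \<Omega> ** ?G) $ p $ p * (\<mu> $ snd p * (1 - \<mu> $ snd p)))"
  have mean: "Ups_mean \<mu> = diag \<nu>" by (simp add: \<nu>_def Ups_mean_eq)
  have \<nu>: "0 < \<nu> $ p" "\<nu> $ p < 1" for p by (simp_all add: \<nu>_def \<mu>)
  have \<kappa>: "0 \<le> (transpose ?G ** \<Omega> ** ?G) $ p $ p" for p
  proof -
    have "(transpose ?G ** \<Omega> ** ?G) $ p $ p = (?G *v axis p 1) \<bullet> (\<Omega> *v (?G *v axis p 1))"
      by (simp only: matrix_entry_axis inner_congruence)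
    then show ?thesis by (simp only: pos_definite_nonneg[OF weights(4)])
  qed
  have d: "0 < d $ p" for p
    using pos_definite_diagonal_entry[OF weights(6)] \<mu> by (simp add: d_def)
  have d'_eq: "d' $ p = d $ p + (transpose ?G ** \<Omega> ** ?G) $ p $ p * (\<nu> $ p * (1 - \<nu> $ p))" for p
    by (simp add: d_def d'_def \<nu>_def)
  have d': "0 < d' $ p" for p
    unfolding d'_eq using d[of p] \<kappa>[of p] \<nu>[of p] by (intro add_pos_nonneg mult_nonneg_nonneg) auto
  obtain K where K: "\<And>x u. quad_cost \<Omega> ?P (?G ** diag \<nu>) d x (K *v x) \<le> quad_cost \<Omega> ?P (?G ** diag \<nu>) d x u"
    by (rule quad_cost_linear_minimizer[OF weights(4) d]) blast
  obtain K' where K': "\<And>x. transpose (?G ** diag \<nu>) *v (\<Omega> *v (?P *v x + (?G ** diag \<nu>) *v (K' *v x))) + diag d' *v (K' *v x) = 0"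
    "\<And>x u. quad_cost \<Omega> ?P (?G ** diag \<nu>) d' x (K' *v x) \<le> quad_cost \<Omega> ?P (?G ** diag \<nu>) d' x u"
    by (rule quad_cost_linear_minimizer[OF weights(4) d']) blast
  have "AE \<omega> in M. Jstar_tcp M A B \<mu> Q \<Omega> \<Psi> X W L k \<omega> = X k \<omega> \<bullet> (Q *v X k \<omega>) + noise_cost \<Omega> k
      + quad_cost \<Omega> ?P (?G ** diag \<nu>) d (X k \<omega>) (K *v X k \<omega>)"
    unfolding Jstar_tcp_def
    by (rule Jstar_AE[OF state_info_tcp _ K]) (unfold d_def mean[symmetric], rule tcp_cost_cond_exp[OF _ weights(5)])
  moreover have "AE \<omega> in M. Jstar_udp M A B \<mu> Q \<Omega> \<Psi> X W L k \<omega> = X k \<omega> \<bullet> (Q *v X k \<omega>) + noise_cost \<Omega> k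
      + quad_cost \<Omega> ?P (?G ** diag \<nu>) d' (X k \<omega>) (K' *v X k \<omega>)"
    unfolding Jstar_udp_def
    by (rule Jstar_AE[OF state_info_udp _ K'(2)])
      (unfold d'_def mean[symmetric], rule udp_cost_cond_exp[OF _ weights(5) pos_definite_sym[OF weights(4)]])
  moreover have "AE \<omega> in M. (transpose ?G ** \<Omega> ** ?P) *v X k \<omega> \<noteq> 0"
    by (rule gaussian_vector_AE_nonzero[OF state(2) nondegenerate])
  ultimately show ?thesis
  proof eventually_elim
    case (elim \<omega>)
    show ?case
      using quad_cost_min_gap[OF weights(4) \<nu> d'_eq elim(3) K K'(1)] by (simp add: elim(1,2))
  qed
qed

end
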